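(* Let $(q,k_0)\in\{(2,3),(3,2)\}$ and let $n,k,d$ be positive integers with $k\ge k_0$ and $qd-(q-1)n\ge 1$. Put $[k]_q=\frac{q^k-1}{q-1}$ and $r=q^{k-1}n-[k]_q\cdot d$, and suppose that $qr\ge k$. (i) There is a one-to-one correspondence between equivalence classes of LCD $[n,k,d]$ codes over $\mathbb{F}_q$ with dual distances $d^\perp\ge 2$ and equivalence classes of LCD $[qr,k,(q-1)r]$ codes over $\mathbb{F}_q$ with dual distances $d^\perp\ge 2$. (ii) If there is no LCD $[qr,k,(q-1)r]$ code over $\mathbb{F}_q$ with dual distance $d^\perp\ge 2$, then there is no LCD $[n,k,d]$ code over $\mathbb{F}_q$ (with any dual distance).
   Context: An $[n,k]$ code over $\mathbb{F}_q$ is a $k$-dimensional subspace $C$ of $\mathbb{F}_q^n$; an $[n,k,d]$ code is one whose minimum weight (the smallest Hamming weight of a nonzero codeword) is exactly $d$. The dual code is $C^\perp=\{x\in\mathbb{F}_q^n: x\cdot y=0 \text{ for all } y\in C\}$ for the standard inner product. $C$ is LCD (linear complementary dual) if $C\cap C^\perp=\{0\}$. The dual distance $d^\perp$ of $C$ is the minimum weight of $C^\perp$. Two $[n,k]$ codes $C_1,C_2$ over $\mathbb{F}_q$ are equivalent if $C_2=\{cP: c\in C_1\}$ for some $n\times n$ monomial matrix $P$ over $\mathbb{F}_q$ (a matrix with exactly one nonzero entry in each row and column). *)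

theory Defs
  imports "Jordan_Normal_Form.VS_Connect" "HOL-Library.Extended_Nat"
begin

text \<open>
  The field with \<open>q\<close> elements is a type \<open>'a :: {field, finite}\<close> with \<open>CARD('a) = q\<close>; its \<open>n\<close>-dimensional
  row space is \<open>carrier_vec n\<close>.
\<close>

definition linear_code :: "nat \<Rightarrow> nat \<Rightarrow> 'a :: field vec set \<Rightarrow> bool" where
  "linear_code n k C \<longleftrightarrow>
     VectorSpace.subspace class_ring C (module_vec TYPE('a) n) \<and>
     vectorspace.dim class_ring ((module_vec TYPE('a) n)\<lparr>carrier := C\<rparr>) = k"

definition hamming_weight :: "'a :: zero vec \<Rightarrow> nat" where
  "hamming_weight c = card {i. i < dim_vec c \<and> c $ i \<noteq> 0}"

text \<open>
  The value is \<open>\<infinity>\<close> for the zero code, which has no nonzero codeword.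
\<close>
definition min_weight :: "nat \<Rightarrow> 'a :: zero vec set \<Rightarrow> enat" where
  "min_weight n C = (INF c \<in> C - {0\<^sub>v n}. enat (hamming_weight c))"

definition linear_code_dist :: "nat \<Rightarrow> nat \<Rightarrow> nat \<Rightarrow> 'a :: field vec set \<Rightarrow> bool" where
  "linear_code_dist n k d C \<longleftrightarrow> linear_code n k C \<and> min_weight n C = enat d"

abbreviation dual_code :: "nat \<Rightarrow> 'a :: field vec set \<Rightarrow> 'a vec set" where
  "dual_code n C \<equiv> vec_module.orthogonal_complement n C"

definition dual_distance :: "nat \<Rightarrow> 'a :: field vec set \<Rightarrow> enat" where
  "dual_distance n C = min_weight n (dual_code n C)"

definition LCD :: "nat \<Rightarrow> 'a :: field vec set \<Rightarrow> bool" where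
  "LCD n C \<longleftrightarrow> C \<inter> dual_code n C = {0\<^sub>v n}"

definition LCD_codes :: "nat \<Rightarrow> nat \<Rightarrow> nat \<Rightarrow> 'a :: field vec set set" where
  "LCD_codes n k d = {C. linear_code_dist n k d C \<and> LCD n C}"

definition LCD_codes_dual2 :: "nat \<Rightarrow> nat \<Rightarrow> nat \<Rightarrow> 'a :: field vec set set" where
  "LCD_codes_dual2 n k d = {C \<in> LCD_codes n k d. dual_distance n C \<ge> 2}"

definition monomial_mat :: "nat \<Rightarrow> 'a :: zero mat \<Rightarrow> bool" where
  "monomial_mat n P \<longleftrightarrow> P \<in> carrier_mat n n \<and>
     (\<forall>i<n. \<exists>!j. j < n \<and> P $$ (i, j) \<noteq> 0) \<and>
     (\<forall>j<n. \<exists>!i. i < n \<and> P $$ (i, j) \<noteq> 0)"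

text \<open>
  The row vector \<open>c P\<close> is written as \<open>P\<^sup>T *\<^sub>v c\<close>, since the library multiplies vectors
  by matrices only from the left.
\<close>
definition code_equiv :: "nat \<Rightarrow> nat \<Rightarrow> ('a :: field vec set \<times> 'a vec set) set" where
  "code_equiv n k = {(C1, C2). linear_code n k C1 \<and> linear_code n k C2 \<and>
     (\<exists>P. monomial_mat n P \<and> C2 = (\<lambda>c. P\<^sup>T *\<^sub>v c) ` C1)}"

text \<open>
  The equivalence classes of codes containing an LCD \<open>[n,k,d]\<close> code with dual distance at least 2.
\<close>
definition LCD_classes_dual2 :: "nat \<Rightarrow> nat \<Rightarrow> nat \<Rightarrow> 'a :: field vec set set set" where
  "LCD_classes_dual2 n k d = LCD_codes_dual2 n k d // code_equiv n k"

text \<open>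
  The number \<open>[k]\<^sub>q = (q ^ k - 1) / (q - 1)\<close>; the division is exact for \<open>q \<ge> 2\<close>.
\<close>
definition q_number :: "nat \<Rightarrow> nat \<Rightarrow> nat" where
  "q_number q k = (q ^ k - 1) div (q - 1)"

end

theory Submission
  imports Defs "HOL-Library.Cardinality" "HOL-Combinatorics.Permutations"
begin

text \<open>
  A linear code of dimension \<open>k\<close> is described by the list \<open>G\<close> of the \<open>n\<close> columns of a generator matrix: its
  codewords are the lists of scalar products of a message \<open>u\<close> with the columns. If no column vanishes, that
  is, if the dual distance is at least 2, then up to monomial equivalence only the multiset of points of
  the projective space \<open>PG(k-1, q)\<close> spanned by the columns matters, up to linear automorphisms
  (\<open>code_equiv_generated_code_iff\<close>). The parameters can be read off from this multiset. The weight of a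
  codeword is the number of points outside a hyperplane. Over the fields with two and three elements
  every nonzero scalar has square 1, so the Gram form \<open>gram\<close>, the sum over all columns \<open>v\<close> of
  \<open>(u \<bullet> v) * (w \<bullet> v)\<close>, depends on the points alone; the code is LCD of full dimension exactly if this form
  is nondegenerate.

  Now add one copy of every point of the projective space. The length grows by \<open>[k]\<^sub>q\<close>, each nonzero
  weight by \<open>q ^ (k - 1)\<close>, and the Gram form does not change, because the Gram form of all points vanishes for
  \<open>q = 2\<close>, \<open>k \<ge> 3\<close> and for \<open>q = 3\<close>, \<open>k \<ge> 2\<close> (\<open>gram_simplex\<close>). Equivalence is respected in both directions, since
  linear automorphisms permute the points. So adding \<open>a\<close> copies of every point maps LCD codes to LCD codes
  (\<open>add_simplices\<close>), and the only question is when \<open>a\<close> copies can be removed again. For an LCD \<open>[n, k, d]\<close>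
  code, sum the nonnegative excess \<open>weight - d\<close> over all messages not orthogonal to a fixed point. The
  resulting inequality says that the point has multiplicity at least \<open>a = q * d - (q - 1) * n\<close>
  (\<open>multiplicity_lower_bound\<close>), so \<open>a\<close> copies can always be removed (\<open>remove_simplices\<close>), and what is left
  has parameters \<open>[q * r, k, (q - 1) * r]\<close>. This is the correspondence (i).

  For (ii) an LCD \<open>[n, k, d]\<close> code with \<open>z\<close> zero columns has to be turned into a code with nonzero columns.
  If \<open>k \<ge> 3\<close>, all zero columns are replaced by one point \<open>p\<close> orthogonal to a message of minimum weight,
  which keeps the minimum weight; among the candidates for \<open>p\<close> there is one for which the rank one change
  of the Gram form keeps it nondegenerate (\<open>fill_zero_columns\<close>). In the remaining case \<open>q = 3\<close>, \<open>k = 2\<close>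
  this may be impossible, but zero columns force \<open>r \<ge> 3\<close>, and for \<open>r \<ge> 2\<close> a \<open>[3 * r, 2, 2 * r]\<close> code of
  the required kind can be written down (\<open>ternary_plane_code\<close>).
\<close>

section \<open>Scalar products over a finite field\<close>

lemma finite_carrier_vec: "finite (carrier_vec k :: 'a :: finite vec set)"
  and card_carrier_vec: "card (carrier_vec k :: 'a :: finite vec set) = CARD('a) ^ k"
proof -
  let ?F = "{..<k} \<rightarrow>\<^sub>E (UNIV :: 'a set)"
  have "bij_betw (\<lambda>f. vec k f) ?F (carrier_vec k)"
    by (rule bij_betwI[where g = "\<lambda>v. \<lambda>i\<in>{..<k}. v $ i"]) (auto simp: fun_eq_iff PiE_iff extensional_def)
  then show "finite (carrier_vec k :: 'a vec set)" "card (carrier_vec k :: 'a vec set) = CARD('a) ^ k"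
    using bij_betw_finite[of "vec k" ?F] bij_betw_same_card[of "vec k" ?F]
    by (auto simp: card_PiE finite_PiE)
qed

text \<open>
  The fibres of \<open>\<phi>\<close> are equally large, because some translation moves any fibre into any other one. This
  is used for the map that takes scalar products with one vector, or with two independent vectors.
\<close>
lemma sum_equidistributed:
  fixes \<phi> :: "'a :: {field, finite} vec \<Rightarrow> 'b"
    and g :: "'b \<Rightarrow> 'c :: comm_semiring_1"
  assumes B: "finite B" "card B = CARD('a) ^ j" and j: "j \<le> k"
    and \<phi>: "\<And>u. u \<in> carrier_vec k \<Longrightarrow> \<phi> u \<in> B"
    and tr: "\<And>b b'. b \<in> B \<Longrightarrow> b' \<in> B \<Longrightarrow>
      \<exists>x\<in>carrier_vec k. \<forall>u\<in>carrier_vec k. \<phi> u = b \<longrightarrow> \<phi> (u + x) = b'"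
  shows "(\<Sum>u\<in>carrier_vec k. g (\<phi> u)) = of_nat (CARD('a) ^ (k - j)) * (\<Sum>b\<in>B. g b)"
proof -
  let ?V = "carrier_vec k :: 'a vec set"
  define fib where "fib b = {u \<in> ?V. \<phi> u = b}" for b
  have fin: "finite (fib b)" for b
    unfolding fib_def by (simp add: finite_carrier_vec)
  have le: "card (fib b) \<le> card (fib b')" if "b \<in> B" "b' \<in> B" for b b'
  proof -
    obtain x where x: "x \<in> ?V" "\<forall>u\<in>?V. \<phi> u = b \<longrightarrow> \<phi> (u + x) = b'"
      using tr \<open>b \<in> B\<close> \<open>b' \<in> B\<close> by blast
    show ?thesis
    proof (rule card_inj_on_le)
      show "inj_on (\<lambda>u. u + x) (fib b)"
      proof (rule inj_onI)
        fix u v assume "u \<in> fib b" "v \<in> fib b" and e: "u + x = v + x"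
        then have uv: "u \<in> ?V" "v \<in> ?V"
          by (auto simp: fib_def)
        show "u = v"
        proof (rule eq_vecI)
          fix i assume "i < dim_vec v"
          then show "u $ i = v $ i"
            using arg_cong[OF e, of "\<lambda>w. w $ i"] uv x(1) by auto
        qed (use uv in auto)
      qed
      show "(\<lambda>u. u + x) ` fib b \<subseteq> fib b'"
        using x by (auto simp: fib_def)
    qed (rule fin)
  qed
  have card_fib: "card (fib b) = CARD('a) ^ (k - j)" if b: "b \<in> B" for b
  proof -
    have "CARD('a) ^ k = card (\<Union>b'\<in>B. fib b')"
      unfolding card_carrier_vec[where 'a = 'a, symmetric]
      by (rule arg_cong[where f = card]) (auto simp: fib_def \<phi>)
    also have "\<dots> = (\<Sum>b'\<in>B. card (fib b'))"
      by (rule card_UN_disjoint) (auto simp: B fin fib_def finite_carrier_vec)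
    also have "\<dots> = (\<Sum>b'\<in>B. card (fib b))"
      by (rule sum.cong) (auto intro: le antisym b)
    also have "\<dots> = CARD('a) ^ j * card (fib b)"
      by (simp add: B)
    finally have "CARD('a) ^ j * card (fib b) = CARD('a) ^ j * CARD('a) ^ (k - j)"
      using j by (simp add: power_add[symmetric])
    then show ?thesis by simp
  qed
  have "(\<Sum>u\<in>?V. g (\<phi> u)) = (\<Sum>b\<in>B. \<Sum>u\<in>fib b. g (\<phi> u))"
    unfolding fib_def
    by (rule sum.group[symmetric]) (auto simp: B finite_carrier_vec \<phi>)
  also have "\<dots> = (\<Sum>b\<in>B. of_nat (CARD('a) ^ (k - j)) * g b)"
  proof (rule sum.cong[OF refl])
    fix b assume b: "b \<in> B"
    have "(\<Sum>u\<in>fib b. g (\<phi> u)) = (\<Sum>u\<in>fib b. g b)"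
      by (rule sum.cong) (auto simp: fib_def)
    then show "(\<Sum>u\<in>fib b. g (\<phi> u)) = of_nat (CARD('a) ^ (k - j)) * g b"
      using card_fib[OF b] by simp
  qed
  finally show ?thesis by (simp add: sum_distrib_left)
qed

lemma scalar_prod_separates:
  fixes p :: "'a :: field vec"
  assumes "p \<in> carrier_vec k" "p \<noteq> 0\<^sub>v k"
  shows "\<exists>x\<in>carrier_vec k. x \<bullet> p = 1"
proof -
  obtain i where i: "i < k" "p $ i \<noteq> 0"
    using assms by (metis carrier_vecD eq_vecI index_zero_vec)
  have "((1 / p $ i) \<cdot>\<^sub>v unit_vec k i) \<bullet> p = 1"
    using assms(1) i by simp
  then show ?thesis
    by (metis smult_carrier_vec unit_vec_carrier)
qed

text \<open>
  If \<open>p $ i \<noteq> 0\<close>, then subtracting a multiple of \<open>unit_vec k i\<close> makes any unit vector orthogonal to \<open>p\<close>; some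
  unit vector modified in this way still sees \<open>v\<close>.
\<close>
lemma scalar_prod_separates_pair:
  fixes p v :: "'a :: field vec"
  assumes p: "p \<in> carrier_vec k" "p \<noteq> 0\<^sub>v k" and v: "v \<in> carrier_vec k"
    and ind: "\<And>a. v \<noteq> a \<cdot>\<^sub>v p"
  shows "\<exists>x\<in>carrier_vec k. x \<bullet> p = 0 \<and> x \<bullet> v = 1"
proof -
  obtain i where i: "i < k" "p $ i \<noteq> 0"
    using p by (metis carrier_vecD eq_vecI index_zero_vec)
  obtain j where j: "j < k" "v $ j \<noteq> (v $ i / p $ i) * p $ j"
    using ind[of "v $ i / p $ i"] p(1) v by (metis carrier_vecD eq_vecI index_smult_vec)
  define x where "x = unit_vec k j - (p $ j / p $ i) \<cdot>\<^sub>v unit_vec k i"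
  have x: "x \<in> carrier_vec k" by (simp add: x_def)
  have dot: "x \<bullet> w = w $ j - (p $ j / p $ i) * w $ i" if "w \<in> carrier_vec k" for w
    using that i j unfolding x_def
    by (simp add: minus_scalar_prod_distrib[of _ k])
  have "x \<bullet> p = 0" using dot[OF p(1)] i by simp
  moreover have "x \<bullet> v \<noteq> 0" using dot[OF v] j by (simp add: mult.commute)
  ultimately have "((1 / (x \<bullet> v)) \<cdot>\<^sub>v x) \<bullet> p = 0 \<and> ((1 / (x \<bullet> v)) \<cdot>\<^sub>v x) \<bullet> v = 1"
    using x p v by simp
  then show ?thesis
    using x by (metis smult_carrier_vec)
qed

lemma sum_scalar_prod:
  fixes p :: "'a :: {field, finite} vec" and g :: "'a \<Rightarrow> 'c :: comm_semiring_1"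
  assumes p: "p \<in> carrier_vec k" "p \<noteq> 0\<^sub>v k" and k: "k \<ge> 1"
  shows "(\<Sum>u\<in>carrier_vec k. g (u \<bullet> p)) = of_nat (CARD('a) ^ (k - 1)) * (\<Sum>b\<in>UNIV. g b)"
proof (rule sum_equidistributed)
  fix b b' :: 'a
  obtain x where x: "x \<in> carrier_vec k" "x \<bullet> p = 1"
    using scalar_prod_separates[OF p] by blast
  show "\<exists>x\<in>carrier_vec k. \<forall>u\<in>carrier_vec k. u \<bullet> p = b \<longrightarrow> (u + x) \<bullet> p = b'"
    by (rule bexI[of _ "(b' - b) \<cdot>\<^sub>v x"])
      (use x p in \<open>auto simp: add_scalar_prod_distrib[of _ k]\<close>)
qed (use k in auto)

lemma sum_scalar_prod_pair:
  fixes p v :: "'a :: {field, finite} vec" and g :: "'a \<Rightarrow> 'a \<Rightarrow> 'c :: comm_semiring_1"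
  assumes p: "p \<in> carrier_vec k" "p \<noteq> 0\<^sub>v k" and v: "v \<in> carrier_vec k"
    and ind: "\<And>a. v \<noteq> a \<cdot>\<^sub>v p" and k: "k \<ge> 2"
  shows "(\<Sum>u\<in>carrier_vec k. g (u \<bullet> p) (u \<bullet> v)) =
    of_nat (CARD('a) ^ (k - 2)) * (\<Sum>b\<in>UNIV. \<Sum>c\<in>UNIV. g b c)"
proof -
  have v0: "v \<noteq> 0\<^sub>v k" using ind[of 0] p by auto
  have ind': "p \<noteq> a \<cdot>\<^sub>v v" for a
  proof
    assume e: "p = a \<cdot>\<^sub>v v"
    then have "a \<noteq> 0" using p v by auto
    then have "v = (1 / a) \<cdot>\<^sub>v p" using e by (auto simp: smult_smult_assoc)
    then show False using ind by blast
  qed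
  obtain x where x: "x \<in> carrier_vec k" "x \<bullet> p = 0" "x \<bullet> v = 1"
    using scalar_prod_separates_pair[OF p v ind] by blast
  obtain y where y: "y \<in> carrier_vec k" "y \<bullet> v = 0" "y \<bullet> p = 1"
    using scalar_prod_separates_pair[OF v v0 p(1) ind'] by blast
  have "(\<Sum>u\<in>carrier_vec k. (\<lambda>(b, c). g b c) (u \<bullet> p, u \<bullet> v)) =
    of_nat (CARD('a) ^ (k - 2)) * (\<Sum>(b, c)\<in>UNIV. g b c)"
  proof (rule sum_equidistributed)
    fix b b' :: "'a \<times> 'a"
    show "\<exists>x\<in>carrier_vec k. \<forall>u\<in>carrier_vec k. (u \<bullet> p, u \<bullet> v) = b \<longrightarrow> ((u + x) \<bullet> p, (u + x) \<bullet> v) = b'"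
      by (rule bexI[of _ "(fst b' - fst b) \<cdot>\<^sub>v y + (snd b' - snd b) \<cdot>\<^sub>v x"])
        (use x y p v in \<open>auto simp: add_scalar_prod_distrib[of _ k]\<close>)
  qed (use k in \<open>auto simp: power2_eq_square card_cartesian_product simp flip: UNIV_Times_UNIV\<close>)
  then show ?thesis
    by (simp add: sum.cartesian_product UNIV_Times_UNIV)
qed

lemma card_scalar_prod_nonzero:
  fixes p :: "'a :: {field, finite} vec"
  assumes p: "p \<in> carrier_vec k" "p \<noteq> 0\<^sub>v k" and k: "k \<ge> 1"
  shows "card {u \<in> carrier_vec k. u \<bullet> p \<noteq> 0} = (CARD('a) - 1) * CARD('a) ^ (k - 1)"
proof -
  have "card {u \<in> carrier_vec k. u \<bullet> p \<noteq> 0} = (\<Sum>u\<in>carrier_vec k. (\<lambda>b. of_bool (b \<noteq> 0)) (u \<bullet> p))"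
    by (simp add: sum_of_bool_eq finite_carrier_vec Int_def)
  also have "\<dots> = CARD('a) ^ (k - 1) * (\<Sum>b\<in>(UNIV :: 'a set). of_bool (b \<noteq> 0))"
    by (subst sum_scalar_prod[OF p k]) simp
  also have "(\<Sum>b\<in>(UNIV :: 'a set). of_bool (b \<noteq> 0)) = card (UNIV - {0 :: 'a})"
    by (simp add: sum_of_bool_eq Compl_eq_Diff_UNIV[symmetric] Collect_neg_eq)
  finally show ?thesis by (simp add: card_Diff_singleton)
qed

lemma card_scalar_prod_nonzero_pair:
  fixes p v :: "'a :: {field, finite} vec"
  assumes p: "p \<in> carrier_vec k" "p \<noteq> 0\<^sub>v k" and v: "v \<in> carrier_vec k"
    and ind: "\<And>a. v \<noteq> a \<cdot>\<^sub>v p" and k: "k \<ge> 2"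
  shows "card {u \<in> carrier_vec k. u \<bullet> p \<noteq> 0 \<and> u \<bullet> v \<noteq> 0} = (CARD('a) - 1)\<^sup>2 * CARD('a) ^ (k - 2)"
proof -
  have c: "(\<Sum>b\<in>(UNIV :: 'a set). of_bool (b \<noteq> 0)) = CARD('a) - 1"
    by (simp add: sum_of_bool_eq Compl_eq_Diff_UNIV[symmetric] Collect_neg_eq)
      (simp add: Compl_eq_Diff_UNIV card_Diff_singleton)
  have "card {u \<in> carrier_vec k. u \<bullet> p \<noteq> 0 \<and> u \<bullet> v \<noteq> 0} =
      (\<Sum>u\<in>carrier_vec k. (\<lambda>b c. of_bool (b \<noteq> 0) * of_bool (c \<noteq> 0)) (u \<bullet> p) (u \<bullet> v))"
    by (simp add: sum_of_bool_eq finite_carrier_vec Int_def flip: of_bool_conj)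
  also have "\<dots> = CARD('a) ^ (k - 2) *
      (\<Sum>b\<in>(UNIV :: 'a set). \<Sum>c\<in>(UNIV :: 'a set). of_bool (b \<noteq> 0) * of_bool (c \<noteq> 0))"
    by (subst sum_scalar_prod_pair[OF p v ind k]) simp
  also have "\<dots> = CARD('a) ^ (k - 2) * ((CARD('a) - 1) * (CARD('a) - 1))"
    by (simp only: c sum_distrib_left[symmetric] sum_distrib_right[symmetric])
  finally show ?thesis by (simp add: power2_eq_square)
qed

section \<open>Multisets of projective points\<close>

text \<open>
  A projective point is encoded by a representative of the class of nonzero scalar multiples of a vector,
  so that multisets of points are multisets of vectors.
\<close>
definition rep :: "'a :: field vec \<Rightarrow> 'a vec" where
  "rep v = (SOME w. \<exists>a. a \<noteq> 0 \<and> w = a \<cdot>\<^sub>v v)"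

lemma rep_smult: "\<exists>a. a \<noteq> 0 \<and> rep v = a \<cdot>\<^sub>v v"
  unfolding rep_def by (rule someI[where x = v]) (metis one_neq_zero one_smult_vec)

lemma rep_of_smult: "a \<noteq> 0 \<Longrightarrow> rep (a \<cdot>\<^sub>v v) = rep v"
proof -
  assume a: "a \<noteq> 0"
  have "(\<exists>b. b \<noteq> 0 \<and> w = b \<cdot>\<^sub>v (a \<cdot>\<^sub>v v)) \<longleftrightarrow> (\<exists>b. b \<noteq> 0 \<and> w = b \<cdot>\<^sub>v v)" for w
  proof safe
    fix b :: 'a assume "b \<noteq> 0"
    then show "\<exists>c. c \<noteq> 0 \<and> b \<cdot>\<^sub>v (a \<cdot>\<^sub>v v) = c \<cdot>\<^sub>v v"
      using a by (intro exI[of _ "b * a"]) (simp add: smult_smult_assoc)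
    show "\<exists>c. c \<noteq> 0 \<and> b \<cdot>\<^sub>v v = c \<cdot>\<^sub>v (a \<cdot>\<^sub>v v)"
      using a \<open>b \<noteq> 0\<close> by (intro exI[of _ "b / a"]) (simp add: smult_smult_assoc)
  qed
  then show ?thesis by (simp add: rep_def)
qed

lemma rep_eq_iff: "rep v = rep w \<longleftrightarrow> (\<exists>a. a \<noteq> 0 \<and> w = a \<cdot>\<^sub>v v)"
proof
  assume e: "rep v = rep w"
  obtain a b where "a \<noteq> 0" "rep v = a \<cdot>\<^sub>v v" "b \<noteq> 0" "rep w = b \<cdot>\<^sub>v w"
    using rep_smult by blast
  then have "a \<cdot>\<^sub>v v = b \<cdot>\<^sub>v w" using e by simp
  then have "(1 / b) \<cdot>\<^sub>v (a \<cdot>\<^sub>v v) = w"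
    using \<open>b \<noteq> 0\<close> by (simp add: smult_smult_assoc)
  then show "\<exists>a. a \<noteq> 0 \<and> w = a \<cdot>\<^sub>v v"
    using \<open>a \<noteq> 0\<close> \<open>b \<noteq> 0\<close> by (intro exI[of _ "a / b"]) (auto simp: smult_smult_assoc)
qed (auto simp: rep_of_smult)

lemma rep_rep [simp]: "rep (rep v) = rep v"
proof -
  obtain a where "a \<noteq> 0" "rep v = a \<cdot>\<^sub>v v" using rep_smult by blast
  then show ?thesis using rep_of_smult[of a v] by simp
qed

lemma rep_carrier [simp]: "rep v \<in> carrier_vec k \<longleftrightarrow> v \<in> carrier_vec k"
  using rep_smult[of v] by auto

lemma smult_vec_eq_0_iff: "(v :: 'a :: field vec) \<in> carrier_vec k \<Longrightarrow> a \<cdot>\<^sub>v v = 0\<^sub>v k \<longleftrightarrow> a = 0 \<or> v = 0\<^sub>v k"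
proof -
  assume v: "v \<in> carrier_vec k"
  have "v = 0\<^sub>v k" if "a \<noteq> 0" "a \<cdot>\<^sub>v v = 0\<^sub>v k"
  proof -
    have "(1 / a) \<cdot>\<^sub>v (a \<cdot>\<^sub>v v) = v" using that(1) by (simp add: smult_smult_assoc)
    then show ?thesis unfolding that(2) by auto
  qed
  then show ?thesis using v by auto
qed

lemma rep_eq_0_iff: "v \<in> carrier_vec k \<Longrightarrow> rep v = 0\<^sub>v k \<longleftrightarrow> v = 0\<^sub>v k"
  using rep_smult[of v] smult_vec_eq_0_iff[of v k] by metis

lemma scalar_prod_rep_eq_0_iff:
  "u \<in> carrier_vec k \<Longrightarrow> v \<in> carrier_vec k \<Longrightarrow> u \<bullet> rep v = 0 \<longleftrightarrow> u \<bullet> v = 0"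
  using rep_smult[of v] by auto

definition points :: "nat \<Rightarrow> 'a :: field vec set" where
  "points k = rep ` (carrier_vec k - {0\<^sub>v k})"

lemma finite_points [simp]: "finite (points k :: 'a :: {field, finite} vec set)"
  by (simp add: points_def finite_carrier_vec)

lemma points_carrier: "points k \<subseteq> carrier_vec k"
  by (auto simp: points_def)

lemma zero_notin_points: "0\<^sub>v k \<notin> points k"
  using rep_eq_0_iff by (force simp: points_def)

lemma rep_points: "p \<in> points k \<Longrightarrow> rep p = p"
  by (auto simp: points_def)

lemma rep_in_points_iff: "v \<in> carrier_vec k \<Longrightarrow> rep v \<in> points k \<longleftrightarrow> v \<noteq> 0\<^sub>v k"
proof -
  assume v: "v \<in> carrier_vec k"
  show ?thesis
  proof (cases "v = 0\<^sub>v k")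
    case True
    then have "rep v = 0\<^sub>v k" using rep_eq_0_iff[OF v] by simp
    then show ?thesis using True zero_notin_points by metis
  next
    case False
    then have "rep v \<in> points k" unfolding points_def using v by blast
    then show ?thesis using False by simp
  qed
qed

lemma points_not_smult:
  assumes "p \<in> points k" "p' \<in> points k" "p \<noteq> p'"
  shows "p' \<noteq> a \<cdot>\<^sub>v p"
proof
  assume e: "p' = a \<cdot>\<^sub>v p"
  then have "a \<noteq> 0"
    using assms(1,2) zero_notin_points[of k] points_carrier[of k] smult_vec_eq_0_iff[of p k a] by auto
  then have "rep p = rep p'" using e rep_eq_iff by blast
  then show False using assms rep_points by metis
qed

text \<open>
  Each point is the representative of \<open>CARD('a) - 1\<close> vectors. Sums over points thus reduce to sums over the
  whole space, where the fibre counts above apply.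
\<close>
lemma sum_points:
  fixes g :: "'a :: {field, finite} vec \<Rightarrow> 'c :: comm_semiring_1"
  shows "of_nat (CARD('a) - 1) * (\<Sum>p\<in>points k. g p) = (\<Sum>v\<in>carrier_vec k - {0\<^sub>v k}. g (rep v))"
proof -
  let ?V = "carrier_vec k - {0\<^sub>v k} :: 'a vec set"
  have "(\<Sum>v\<in>?V. g (rep v)) = (\<Sum>p\<in>points k. \<Sum>v\<in>{v \<in> ?V. rep v = p}. g (rep v))"
    by (rule sum.group[symmetric]) (auto simp: finite_carrier_vec points_def)
  also have "\<dots> = (\<Sum>p\<in>points k. of_nat (CARD('a) - 1) * g p)"
  proof (rule sum.cong[OF refl])
    fix p :: "'a vec" assume p: "p \<in> points k"
    then have pc: "p \<in> carrier_vec k" "p \<noteq> 0\<^sub>v k"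
      using points_carrier zero_notin_points by auto
    then obtain i where i: "i < k" "p $ i \<noteq> 0"
      by (metis carrier_vecD eq_vecI index_zero_vec)
    have fib: "{v \<in> ?V. rep v = p} = (\<lambda>a. a \<cdot>\<^sub>v p) ` (UNIV - {0})"
    proof (intro equalityI subsetI)
      fix v assume "v \<in> {v \<in> ?V. rep v = p}"
      then have "rep p = rep v" using rep_points[OF p] by simp
      then obtain a where "a \<noteq> 0" "v = a \<cdot>\<^sub>v p" unfolding rep_eq_iff by blast
      then show "v \<in> (\<lambda>a. a \<cdot>\<^sub>v p) ` (UNIV - {0})" by blast
    next
      fix v assume "v \<in> (\<lambda>a. a \<cdot>\<^sub>v p) ` (UNIV - {0})"
      then obtain a where "a \<noteq> 0" "v = a \<cdot>\<^sub>v p" by blast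
      then show "v \<in> {v \<in> ?V. rep v = p}"
        using pc rep_points[OF p] rep_of_smult[of a p] smult_vec_eq_0_iff[OF pc(1), of a] by simp
    qed
    have "inj_on (\<lambda>a. a \<cdot>\<^sub>v p) (UNIV - {0})"
    proof (rule inj_onI)
      fix a b :: 'a assume "a \<cdot>\<^sub>v p = b \<cdot>\<^sub>v p"
      from arg_cong[OF this, of "\<lambda>w. w $ i"] show "a = b" using i pc by simp
    qed
    then have "card {v \<in> ?V. rep v = p} = CARD('a) - 1"
      unfolding fib by (simp add: card_image card_Diff_singleton)
    then show "(\<Sum>v\<in>{v \<in> ?V. rep v = p}. g (rep v)) = of_nat (CARD('a) - 1) * g p"
      by simp
  qed
  finally show ?thesis by (simp add: sum_distrib_left)
qed

lemma card_field_ge_2: "CARD('a :: {field, finite}) \<ge> 2"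
proof -
  have "card {0, 1 :: 'a} \<le> CARD('a)" by (rule card_mono) auto
  then show ?thesis by simp
qed

lemma card_points: "(CARD('a) - 1) * card (points k :: 'a :: {field, finite} vec set) = CARD('a) ^ k - 1"
  using sum_points[of "\<lambda>_ :: 'a vec. 1 :: nat" k]
  by (simp add: finite_carrier_vec card_carrier_vec card_Diff_singleton)

lemma card_points_not_orthogonal:
  fixes u :: "'a :: {field, finite} vec"
  assumes u: "u \<in> carrier_vec k" "u \<noteq> 0\<^sub>v k" and k: "k \<ge> 1"
  shows "card {p \<in> points k. u \<bullet> p \<noteq> 0} = CARD('a) ^ (k - 1)"
proof -
  have "(CARD('a) - 1) * card {p \<in> points k. u \<bullet> p \<noteq> 0} =
      (CARD('a) - 1) * (\<Sum>p\<in>points k. of_bool (u \<bullet> p \<noteq> 0))"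
    by (simp add: sum_of_bool_eq Int_def)
  also have "\<dots> = (\<Sum>v\<in>carrier_vec k - {0\<^sub>v k}. of_bool (u \<bullet> rep v \<noteq> 0))"
    using sum_points[of "\<lambda>p. of_bool (u \<bullet> p \<noteq> 0) :: nat" k] by simp
  also have "\<dots> = card {v \<in> carrier_vec k. v \<bullet> u \<noteq> 0}"
    using u by (simp add: sum_of_bool_eq finite_carrier_vec)
      (intro arg_cong[where f = card], auto simp: scalar_prod_rep_eq_0_iff comm_scalar_prod[of _ k])
  also have "\<dots> = (CARD('a) - 1) * CARD('a) ^ (k - 1)"
    by (rule card_scalar_prod_nonzero[OF u k])
  finally show ?thesis using card_field_ge_2[where 'a = 'a] by simp
qed

text \<open>
  Translation by 1 permutes the field, so the sum of all elements is unchanged when 1 is added to each.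
\<close>
lemma of_nat_card_field: "of_nat CARD('a :: {field, finite}) = (0 :: 'a)"
proof -
  have "(\<Sum>x\<in>UNIV. x) = (\<Sum>x\<in>UNIV. x + (1 :: 'a))"
    by (rule sum.reindex_bij_witness[of _ "\<lambda>x. x + 1" "\<lambda>x. x - 1"]) auto
  then show ?thesis by (simp add: sum.distrib)
qed

text \<open>
  What singles out the fields of order two and three: rescaling a column leaves the Gram form unchanged.
\<close>
lemma square_eq_1_small_field:
  assumes "CARD('a :: {field, finite}) \<in> {2, 3}" "(a :: 'a) \<noteq> 0"
  shows "a * a = 1"
proof (cases "a = 1")
  case False
  have "card {0, 1, a} \<le> CARD('a)" by (rule card_mono) auto
  with False assms have "card {0, 1, a} = CARD('a)" by auto
  then have "{0, 1, a} = UNIV" by (intro card_subset_eq) auto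
  then have "a * a \<in> {0, 1, a}" by blast
  then show ?thesis using assms(2) False by auto
qed simp

text \<open>
  The sum is a multiple of \<open>q ^ (k - 1)\<close> if \<open>u\<close> and \<open>w\<close> are dependent, and of \<open>q ^ (k - 2)\<close> times the square of
  the sum of all field elements if they are independent. Since \<open>q = 0\<close> in the field, the first vanishes. The
  second vanishes for \<open>k \<ge> 3\<close>, and for \<open>q = 3\<close> also with \<open>k = 2\<close>, because the elements of the field of
  order three add up to 0; in the field of order two they add up to 1, whence the stronger bound on \<open>k\<close>.
\<close>
lemma sum_scalar_prod_square:
  fixes u w :: "'a :: {field, finite} vec"
  assumes qk: "CARD('a) = 2 \<and> k \<ge> 3 \<or> CARD('a) = 3 \<and> k \<ge> 2"
    and u: "u \<in> carrier_vec k" and w: "w \<in> carrier_vec k"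
  shows "(\<Sum>v\<in>carrier_vec k. (v \<bullet> u) * (v \<bullet> w)) = 0"
proof -
  have k: "k \<ge> 2" using qk by auto
  consider "u = 0\<^sub>v k" | a where "u \<noteq> 0\<^sub>v k" "w = a \<cdot>\<^sub>v u" | "u \<noteq> 0\<^sub>v k" "\<And>a. w \<noteq> a \<cdot>\<^sub>v u"
    by blast
  then show ?thesis
  proof cases
    case 1
    then show ?thesis by (intro sum.neutral) auto
  next
    case (2 a)
    have "(\<Sum>v\<in>carrier_vec k. (v \<bullet> u) * (v \<bullet> w)) = (\<Sum>v\<in>carrier_vec k. (\<lambda>b. a * (b * b)) (v \<bullet> u))"
      using 2 u by (intro sum.cong) auto
    also have "\<dots> = of_nat (CARD('a) ^ (k - 1)) * (\<Sum>b\<in>UNIV. a * (b * b))"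
      using k 2 by (subst sum_scalar_prod[OF u]) auto
    also have "\<dots> = 0" using k by (simp add: of_nat_card_field power_0_left)
    finally show ?thesis .
  next
    case 3
    have "(\<Sum>v\<in>carrier_vec k. (v \<bullet> u) * (v \<bullet> w)) =
        of_nat (CARD('a) ^ (k - 2)) * ((\<Sum>b\<in>(UNIV :: 'a set). b) * (\<Sum>b\<in>UNIV. b))"
      by (subst sum_scalar_prod_pair[OF u 3(1) w 3(2) k]) (auto simp: sum_product)
    also have "\<dots> = 0"
    proof (cases "CARD('a) = 2")
      case True
      then have "(2 :: 'a) = 0" "k - 2 > 0" using qk of_nat_card_field[where 'a = 'a] by auto
      then show ?thesis using True by simp
    next
      case False
      then have three: "(3 :: 'a) = 0"
        using qk of_nat_card_field[where 'a = 'a] by simp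
      let ?s = "\<Sum>b\<in>(UNIV :: 'a set). b"
      have "?s = (\<Sum>b\<in>(UNIV :: 'a set). - b)"
        by (rule sum.reindex_bij_witness[of _ uminus uminus]) auto
      then have "?s = - ?s" by (simp add: sum_negf)
      then have two: "2 * ?s = 0" by (simp only: mult_2 eq_neg_iff_add_eq_0)
      have "?s = 3 * ?s - 2 * ?s" by (simp add: algebra_simps)
      also have "\<dots> = 0" unfolding two three by simp
      finally have "?s = 0" .
      then show ?thesis by simp
    qed
    finally show ?thesis .
  qed
qed

text \<open>
  \<open>wt M u\<close> is the Hamming weight of the codeword of message \<open>u\<close>, and \<open>gram M u w\<close> the scalar product of two
  codewords, if \<open>M\<close> is the multiset of columns of a generator matrix.
\<close>
definition wt :: "'a :: field vec multiset \<Rightarrow> 'a vec \<Rightarrow> nat" where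
  "wt M u = size {#v \<in># M. u \<bullet> v \<noteq> 0#}"

definition gram :: "'a :: field vec multiset \<Rightarrow> 'a vec \<Rightarrow> 'a vec \<Rightarrow> 'a" where
  "gram M u w = (\<Sum>v\<in>#M. (u \<bullet> v) * (w \<bullet> v))"

lemma wt_empty [simp]: "wt {#} u = 0"
  and wt_add [simp]: "wt (add_mset v M) u = of_bool (u \<bullet> v \<noteq> 0) + wt M u"
  and wt_union [simp]: "wt (M + N) u = wt M u + wt N u"
  by (auto simp: wt_def)

lemma wt_repeat [simp]: "wt (repeat_mset a M) u = a * wt M u"
  by (induction a) auto

lemma gram_empty [simp]: "gram {#} u w = 0"
  and gram_add [simp]: "gram (add_mset v M) u w = (u \<bullet> v) * (w \<bullet> v) + gram M u w"
  and gram_union [simp]: "gram (M + N) u w = gram M u w + gram N u w"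
  by (auto simp: gram_def)

lemma gram_repeat [simp]: "gram (repeat_mset a M) u w = of_nat a * gram M u w"
  by (induction a) (auto simp: algebra_simps)

lemma wt_image_rep:
  "set_mset M \<subseteq> carrier_vec k \<Longrightarrow> u \<in> carrier_vec k \<Longrightarrow> wt (image_mset rep M) u = wt M u"
  by (induction M) (auto simp: scalar_prod_rep_eq_0_iff)

lemma gram_image_rep:
  fixes M :: "'a :: {field, finite} vec multiset"
  assumes q: "CARD('a) \<in> {2, 3}" and u: "u \<in> carrier_vec k" and w: "w \<in> carrier_vec k"
  shows "set_mset M \<subseteq> carrier_vec k \<Longrightarrow> gram (image_mset rep M) u w = gram M u w"
proof (induction M)
  case (add v M)
  then have v: "v \<in> carrier_vec k" by simp
  obtain a where a: "a \<noteq> 0" "rep v = a \<cdot>\<^sub>v v" using rep_smult by blast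
  have "(u \<bullet> rep v) * (w \<bullet> rep v) = (a * a) * ((u \<bullet> v) * (w \<bullet> v))"
    using a u v w by (simp add: algebra_simps)
  then have "(u \<bullet> rep v) * (w \<bullet> rep v) = (u \<bullet> v) * (w \<bullet> v)"
    using square_eq_1_small_field[OF q a(1)] by simp
  then show ?case using add by simp
qed simp

text \<open>
  The columns of a generator matrix of the simplex code: every point once.
\<close>
abbreviation simplex :: "nat \<Rightarrow> 'a :: {field, finite} vec multiset" where
  "simplex k \<equiv> mset_set (points k)"

lemma wt_simplex:
  fixes u :: "'a :: {field, finite} vec"
  assumes "u \<in> carrier_vec k" "u \<noteq> 0\<^sub>v k" "k \<ge> 1"
  shows "wt (simplex k) u = CARD('a) ^ (k - 1)"
  using card_points_not_orthogonal[OF assms] by (simp add: wt_def filter_mset_mset_set)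

lemma gram_simplex:
  fixes u w :: "'a :: {field, finite} vec"
  assumes qk: "CARD('a) = 2 \<and> k \<ge> 3 \<or> CARD('a) = 3 \<and> k \<ge> 2"
    and u: "u \<in> carrier_vec k" and w: "w \<in> carrier_vec k"
  shows "gram (simplex k) u w = 0"
proof -
  have q: "CARD('a) \<in> {2, 3}" using qk by auto
  have dots: "(u \<bullet> rep v) * (w \<bullet> rep v) = (v \<bullet> u) * (v \<bullet> w)" if "v \<in> carrier_vec k" for v
    using gram_image_rep[OF q u w, of "{#v#}"] that u w
    by (simp add: comm_scalar_prod[of _ k])
  have "of_nat (CARD('a) - 1) * (\<Sum>p\<in>points k. (u \<bullet> p) * (w \<bullet> p)) =
      (\<Sum>v\<in>carrier_vec k - {0\<^sub>v k}. (u \<bullet> rep v) * (w \<bullet> rep v))"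
    by (rule sum_points)
  also have "\<dots> = (\<Sum>v\<in>carrier_vec k - {0\<^sub>v k}. (v \<bullet> u) * (v \<bullet> w))"
    by (rule sum.cong) (auto simp: dots)
  also have "\<dots> = (\<Sum>v\<in>carrier_vec k. (v \<bullet> u) * (v \<bullet> w))"
    using u w by (intro sum.mono_neutral_left) (auto simp: finite_carrier_vec)
  also have "\<dots> = 0" by (rule sum_scalar_prod_square[OF qk u w])
  finally have "of_nat (CARD('a) - 1) * (\<Sum>p\<in>points k. (u \<bullet> p) * (w \<bullet> p)) = 0" .
  moreover have "of_nat (CARD('a) - 1) = (- 1 :: 'a)"
    using card_field_ge_2[where 'a = 'a] of_nat_card_field[where 'a = 'a] by (simp add: of_nat_diff)
  ultimately have "(\<Sum>p\<in>points k. (u \<bullet> p) * (w \<bullet> p)) = 0"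
    by simp
  then show ?thesis
    by (simp add: gram_def sum_unfold_sum_mset)
qed

text \<open>
  Double counting of the pairs of a message and a column that are not orthogonal.
\<close>
lemma sum_wt:
  assumes "finite U"
  shows "(\<Sum>u\<in>U. wt M u) = (\<Sum>v\<in>#M. card {u \<in> U. u \<bullet> v \<noteq> 0})"
proof (induction M)
  case (add v M)
  have "(\<Sum>u\<in>U. of_bool (u \<bullet> v \<noteq> 0)) = card {u \<in> U. u \<bullet> v \<noteq> (0 :: 'a)}"
    using assms by (simp add: sum_of_bool_eq Int_def)
  then show ?case using add by (simp add: sum.distrib)
qed simp

text \<open>
  The decisive inequality. Sum the weights over the messages \<open>u\<close> with \<open>u \<bullet> p \<noteq> 0\<close>. A column equal to \<open>p\<close> is
  nonzero on all of them, any other point only on the fraction \<open>(q - 1) / q\<close>. Hence, up to the common factor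
  \<open>(q - 1) * q ^ (k - 2)\<close>, the sum is \<open>(q - 1) * size M + count M p\<close>, and it is at least \<open>q * d\<close>, as each
  summand is at least \<open>d\<close>.
\<close>
lemma multiplicity_lower_bound:
  fixes M :: "'a :: {field, finite} vec multiset"
  assumes k: "k \<ge> 2" and M: "set_mset M \<subseteq> points k" and p: "p \<in> points k"
    and d: "\<And>u. u \<in> carrier_vec k \<Longrightarrow> u \<noteq> 0\<^sub>v k \<Longrightarrow> d \<le> wt M u"
  shows "CARD('a) * d \<le> (CARD('a) - 1) * size M + count M p"
proof -
  let ?q = "CARD('a)"
  let ?U = "{u \<in> carrier_vec k. u \<bullet> p \<noteq> 0}"
  have pc: "p \<in> carrier_vec k" "p \<noteq> 0\<^sub>v k"
    using p points_carrier zero_notin_points by auto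
  have fin: "finite ?U" by (simp add: finite_carrier_vec)
  have qk: "?q ^ (k - 1) = ?q * ?q ^ (k - 2)"
    using k by (simp flip: power_Suc add: Suc_diff_Suc numeral_2_eq_2)
  have cU: "card ?U = (?q - 1) * ?q ^ (k - 2) * ?q"
    using card_scalar_prod_nonzero[OF pc] k qk by (simp add: mult_ac)
  have cUv: "card {u \<in> ?U. u \<bullet> v \<noteq> 0} =
      (?q - 1) * ?q ^ (k - 2) * (if v = p then ?q else ?q - 1)" if "v \<in> points k" for v
  proof (cases "v = p")
    case True
    then have "{u \<in> ?U. u \<bullet> v \<noteq> 0} = ?U" by auto
    then show ?thesis using cU True by simp
  next
    case False
    have "v \<in> carrier_vec k" using that points_carrier by auto
    then show ?thesis
      using card_scalar_prod_nonzero_pair[OF pc _ points_not_smult[OF p that] k] False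
      by (auto simp: power2_eq_square mult_ac conj_assoc)
  qed
  have "(?q - 1) * ?q ^ (k - 2) * (?q * d) = (\<Sum>u\<in>?U. d)"
    by (simp add: cU)
  also have "\<dots> \<le> (\<Sum>u\<in>?U. wt M u)"
    by (rule sum_mono) (use d pc in \<open>auto intro!: d\<close>)
  also have "\<dots> = (\<Sum>v\<in>#M. card {u \<in> ?U. u \<bullet> v \<noteq> 0})"
    by (rule sum_wt[OF fin])
  also have "\<dots> = (\<Sum>v\<in>#M. (?q - 1) * ?q ^ (k - 2) * (if v = p then ?q else ?q - 1))"
    using M by (intro arg_cong[where f = sum_mset] image_mset_cong cUv) auto
  also have "\<dots> = (?q - 1) * ?q ^ (k - 2) * (\<Sum>v\<in>#M. (if v = p then ?q else ?q - 1))"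
    by (simp add: sum_mset_distrib_left image_mset.compositionality o_def)
  also have "(\<Sum>v\<in>#M. (if v = p then ?q else ?q - 1)) = (?q - 1) * size M + count M p"
  proof -
    obtain c where "?q = Suc c" using card_field_ge_2[where 'a = 'a] by (cases ?q) auto
    then show ?thesis by (induction M) auto
  qed
  finally show ?thesis using card_field_ge_2[where 'a = 'a] by simp
qed

section \<open>Codes and their generator matrices\<close>

text \<open>
  The list \<open>G\<close> holds the columns of a generator matrix, and \<open>u\<close> is the message.
\<close>
definition codeword :: "'a :: field vec list \<Rightarrow> 'a vec \<Rightarrow> 'a vec" where
  "codeword G u = vec (length G) (\<lambda>i. u \<bullet> G ! i)"

definition generated_code :: "nat \<Rightarrow> 'a :: field vec list \<Rightarrow> 'a vec set" where
  "generated_code k G = codeword G ` carrier_vec k"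

lemma codeword_carrier [simp]: "codeword G u \<in> carrier_vec (length G)"
  by (simp add: codeword_def)

lemma nth_carrier: "set G \<subseteq> carrier_vec k \<Longrightarrow> i < length G \<Longrightarrow> G ! i \<in> carrier_vec k"
  by (meson nth_mem subsetD)

lemma codeword_add:
  assumes "set G \<subseteq> carrier_vec k" "u \<in> carrier_vec k" "w \<in> carrier_vec k"
  shows "codeword G (u + w) = codeword G u + codeword G w"
  using assms by (intro eq_vecI) (auto simp: codeword_def add_scalar_prod_distrib[of _ k] nth_carrier)

lemma codeword_smult:
  assumes "set G \<subseteq> carrier_vec k" "u \<in> carrier_vec k"
  shows "codeword G (a \<cdot>\<^sub>v u) = a \<cdot>\<^sub>v codeword G u"
  using assms by (intro eq_vecI) (auto simp: codeword_def nth_carrier smult_scalar_prod_distrib[of _ k])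

lemma codeword_zero: "set G \<subseteq> carrier_vec k \<Longrightarrow> codeword G (0\<^sub>v k) = 0\<^sub>v (length G)"
  by (intro eq_vecI) (auto simp: codeword_def nth_carrier)

lemma inj_codeword_iff:
  assumes G: "set G \<subseteq> carrier_vec k"
  shows "inj_on (codeword G) (carrier_vec k) \<longleftrightarrow>
    (\<forall>u\<in>carrier_vec k. codeword G u = 0\<^sub>v (length G) \<longrightarrow> u = 0\<^sub>v k)"
proof
  assume inj: "inj_on (codeword G) (carrier_vec k)"
  show "\<forall>u\<in>carrier_vec k. codeword G u = 0\<^sub>v (length G) \<longrightarrow> u = 0\<^sub>v k"
    using inj_onD[OF inj, of _ "0\<^sub>v k"] codeword_zero[OF G] by auto
next
  assume ker: "\<forall>u\<in>carrier_vec k. codeword G u = 0\<^sub>v (length G) \<longrightarrow> u = 0\<^sub>v k"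
  show "inj_on (codeword G) (carrier_vec k)"
  proof (rule inj_onI)
    fix u w :: "'a vec"
    assume u: "u \<in> carrier_vec k" and w: "w \<in> carrier_vec k" and e: "codeword G u = codeword G w"
    have "codeword G (u + (- 1) \<cdot>\<^sub>v w) = codeword G w + (- 1) \<cdot>\<^sub>v codeword G w"
      using codeword_add[OF G u, of "(- 1) \<cdot>\<^sub>v w"] codeword_smult[OF G w, of "- 1"] w e by simp
    also have "\<dots> = 0\<^sub>v (length G)" by (intro eq_vecI) (auto simp: codeword_def)
    finally have "u + (- 1) \<cdot>\<^sub>v w = 0\<^sub>v k" using ker u w by simp
    show "u = w"
    proof (rule eq_vecI)
      fix i assume "i < dim_vec w"
      then show "u $ i = w $ i"
        using arg_cong[OF \<open>u + (- 1) \<cdot>\<^sub>v w = 0\<^sub>v k\<close>, of "\<lambda>v. v $ i"] u w by simp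
    qed (use u w in auto)
  qed
qed

lemma hamming_weight_codeword: "hamming_weight (codeword G u) = wt (mset G) u"
proof -
  have "hamming_weight (codeword G u) = card {i. i < length G \<and> u \<bullet> G ! i \<noteq> 0}"
    unfolding hamming_weight_def by (rule arg_cong[where f = card]) (auto simp: codeword_def)
  also have "\<dots> = wt (mset G) u"
    by (simp add: wt_def length_filter_conv_card flip: mset_filter)
  finally show ?thesis .
qed

lemma scalar_prod_codeword: "codeword G u \<bullet> codeword G w = gram (mset G) u w"
proof -
  have "codeword G u \<bullet> codeword G w = (\<Sum>i = 0..<length G. (u \<bullet> G ! i) * (w \<bullet> G ! i))"
    by (simp add: scalar_prod_def codeword_def)
  also have "\<dots> = sum_list (map (\<lambda>v. (u \<bullet> v) * (w \<bullet> v)) G)"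
    by (simp add: sum_list_sum_nth)
  also have "\<dots> = gram (mset G) u w"
    by (simp add: gram_def sum_mset_sum_list flip: mset_map)
  finally show ?thesis .
qed

lemma generated_code_carrier: "generated_code k G \<subseteq> carrier_vec (length G)"
  by (auto simp: generated_code_def)

lemma generated_code_subspace:
  fixes G :: "'a :: field vec list"
  assumes G: "set G \<subseteq> carrier_vec k"
  shows "VectorSpace.subspace class_ring (generated_code k G) (module_vec TYPE('a) (length G))"
  unfolding VectorSpace.subspace_def
proof (intro conjI)
  show "vectorspace class_ring (module_vec TYPE('a) (length G))" by (rule vec_vs)
  show "submodule class_ring (generated_code k G) (module_vec TYPE('a) (length G))"
  proof (rule submodule.intro)
    fix v w assume "v \<in> generated_code k G" "w \<in> generated_code k G"
    then obtain u u' where *: "u \<in> carrier_vec k" "u' \<in> carrier_vec k" "v = codeword G u" "w = codeword G u'"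
      by (auto simp: generated_code_def)
    then have "v + w = codeword G (u + u')" using codeword_add[OF G] by simp
    then show "v \<oplus>\<^bsub>module_vec TYPE('a) (length G)\<^esub> w \<in> generated_code k G"
      using * by (simp add: generated_code_def module_vec_simps)
  next
    fix c v assume "v \<in> generated_code k G"
    then obtain u where *: "u \<in> carrier_vec k" "v = codeword G u"
      by (auto simp: generated_code_def)
    then have "c \<cdot>\<^sub>v v = codeword G (c \<cdot>\<^sub>v u)" using codeword_smult[OF G] by simp
    then show "c \<odot>\<^bsub>module_vec TYPE('a) (length G)\<^esub> v \<in> generated_code k G"
      using * by (simp add: generated_code_def module_vec_simps)
  next
    show "\<zero>\<^bsub>module_vec TYPE('a) (length G)\<^esub> \<in> generated_code k G"
      using imageI[of "0\<^sub>v k" "carrier_vec k" "codeword G"] codeword_zero[OF G]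
      by (simp add: generated_code_def module_vec_simps)
  qed (use generated_code_carrier in \<open>auto simp: vec_module module_vec_simps\<close>)
qed

text \<open>
  The columns of the generator matrix collect the coordinates of a basis of the code.
\<close>
lemma linear_code_generated:
  fixes C :: "'a :: {field, finite} vec set"
  assumes C: "linear_code n k C"
  shows "\<exists>G. length G = n \<and> set G \<subseteq> carrier_vec k \<and> inj_on (codeword G) (carrier_vec k) \<and>
    C = generated_code k G"
proof -
  interpret V: vec_space "TYPE('a)" n .
  have sub: "VectorSpace.subspace class_ring C V.V"
    and dim: "vectorspace.dim class_ring (V.vs C) = k"
    using C by (auto simp: linear_code_def)
  interpret W: vectorspace class_ring "V.vs C" by (rule V.subspace_is_vs[OF sub])
  have submod: "submodule class_ring C V.V" using sub by (rule V.is_module)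
  have CV: "C \<subseteq> carrier_vec n"
    using submodule.subset[OF submod] by (simp add: module_vec_simps)
  have finC: "finite C" using CV finite_carrier_vec by (rule finite_subset)
  have "W.span C = C"
    using V.span_li_not_depend(1)[OF _ submod, of C] W.in_own_span[of C] W.span_is_subset2[of C] by auto
  then have "W.fin_dim"
    unfolding W.fin_dim_def using finC by (intro exI[of _ C]) auto
  then obtain B where B: "finite B" "W.basis B" using W.finite_basis_exists by blast
  have BC: "B \<subseteq> C" using B(2) by (auto simp: W.basis_def)
  have BV: "B \<subseteq> carrier_vec n" using BC CV by auto
  have spanB: "V.span B = C"
    using B(2) V.span_li_not_depend(1)[OF BC submod] by (simp add: W.basis_def)
  have indB: "\<not> V.lin_dep B"
    using B(2) V.span_li_not_depend(2)[OF BC submod] by (simp add: W.basis_def)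
  have cardB: "card B = k" using W.dim_basis[OF B] dim by simp
  obtain bs where bs: "set bs = B" "distinct bs" using finite_distinct_list[OF B(1)] by blast
  have lbs: "length bs = k" using bs cardB distinct_card by force
  define G where "G = map (\<lambda>i. vec k (\<lambda>j. (bs ! j) $ i)) [0..<n]"
  have lG: "length G = n" and Gc: "set G \<subseteq> carrier_vec k" by (auto simp: G_def)
  define co where "co u = (\<lambda>b. u $ (THE j. j < k \<and> bs ! j = b))" for u :: "'a vec"
  have co: "co u (bs ! j) = u $ j" if "j < k" for u j
  proof -
    have "(THE i. i < k \<and> bs ! i = bs ! j) = j"
      using that bs lbs by (intro the_equality) (auto simp: nth_eq_iff_index_eq)
    then show ?thesis by (simp add: co_def)
  qed
  have bij: "bij_betw (\<lambda>j. bs ! j) {..<k} B"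
    using bij_betw_nth[OF bs(2) refl bs(1)[symmetric]] lbs by simp
  have cw: "codeword G u = V.lincomb (co u) B" if "u \<in> carrier_vec k" for u
  proof (rule eq_vecI)
    show "dim_vec (codeword G u) = dim_vec (V.lincomb (co u) B)"
      using V.lincomb_dim[OF B(1) BV] by (simp add: codeword_def lG)
    fix i assume "i < dim_vec (V.lincomb (co u) B)"
    then have i: "i < n" using V.lincomb_dim[OF B(1) BV] by simp
    have "V.lincomb (co u) B $ i = (\<Sum>b\<in>B. co u b * b $ i)"
      by (rule V.lincomb_index[OF i BV])
    also have "\<dots> = (\<Sum>j<k. co u (bs ! j) * (bs ! j) $ i)"
      by (rule sum.reindex_bij_betw[OF bij, symmetric])
    also have "\<dots> = codeword G u $ i"
      using i lG by (simp add: codeword_def scalar_prod_def G_def co atLeast0LessThan)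
    finally show "codeword G u $ i = V.lincomb (co u) B $ i" by simp
  qed
  have gen: "C = generated_code k G"
  proof (rule Set.set_eqI)
    fix c
    have "c \<in> C \<longleftrightarrow> (\<exists>a. c = V.lincomb a B)"
      using V.finite_span[OF B(1) BV] spanB by auto
    also have "\<dots> \<longleftrightarrow> (\<exists>u\<in>carrier_vec k. c = V.lincomb (co u) B)"
    proof safe
      fix a
      have "V.lincomb a B = V.lincomb (co (vec k (\<lambda>j. a (bs ! j)))) B"
      proof (rule V.lincomb_cong)
        fix b assume "b \<in> B"
        then obtain j where "j < k" "b = bs ! j" using bij by (auto simp: bij_betw_def)
        then show "a b = co (vec k (\<lambda>j. a (bs ! j))) b" using co by simp
      qed (use BV in auto)
      then show "\<exists>u\<in>carrier_vec k. V.lincomb a B = V.lincomb (co u) B" by (metis vec_carrier)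
    qed auto
    also have "\<dots> \<longleftrightarrow> c \<in> generated_code k G"
      using cw by (auto simp: generated_code_def image_iff)
    finally show "c \<in> C \<longleftrightarrow> c \<in> generated_code k G" .
  qed
  have "inj_on (codeword G) (carrier_vec k)"
    unfolding inj_codeword_iff[OF Gc]
  proof (intro ballI impI)
    fix u :: "'a vec" assume u: "u \<in> carrier_vec k" and z: "codeword G u = 0\<^sub>v (length G)"
    then have lc: "V.lincomb (co u) B = 0\<^sub>v n" using cw lG by simp
    have "co u b = 0" if "b \<in> B" for b
      using V.not_lindepD[OF indB B(1) subset_refl _ lc] that by auto
    then have "u $ j = 0" if "j < k" for j
      using co[OF that, of u] bij that by (auto simp: bij_betw_def)
    then show "u = 0\<^sub>v k" using u by (intro eq_vecI) auto
  qed
  then show ?thesis using lG Gc gen by blast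
qed

text \<open>
  Conversely, the dimension of a code generated by \<open>k\<close> independent rows is found by counting: a code of
  dimension \<open>m\<close> has \<open>q ^ m\<close> codewords by the previous lemma.
\<close>
lemma linear_code_iff_generated:
  fixes C :: "'a :: {field, finite} vec set"
  shows "linear_code n k C \<longleftrightarrow>
    (\<exists>G. length G = n \<and> set G \<subseteq> carrier_vec k \<and> inj_on (codeword G) (carrier_vec k) \<and> C = generated_code k G)"
proof
  assume "\<exists>G. length G = n \<and> set G \<subseteq> carrier_vec k \<and> inj_on (codeword G) (carrier_vec k) \<and> C = generated_code k G"
  then obtain G where G: "length G = n" "set G \<subseteq> carrier_vec k"
      "inj_on (codeword G) (carrier_vec k)" "C = generated_code k G" by blast
  have card: "card (generated_code m H) = CARD('a) ^ m"
    if "inj_on (codeword H) (carrier_vec m)" for m and H :: "'a vec list"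
    using that by (simp add: generated_code_def card_image card_carrier_vec)
  define m where "m = vectorspace.dim class_ring ((module_vec TYPE('a) n)\<lparr>carrier := C\<rparr>)"
  have "linear_code n m C"
    using generated_code_subspace[OF G(2)] G(1,4) by (simp add: linear_code_def m_def)
  moreover from linear_code_generated[OF this] have "card C = CARD('a) ^ m"
    using card by metis
  then have "m = k"
    using card[OF G(3)] G(4) card_field_ge_2[where 'a = 'a] by (simp add: power_inject_exp)
  ultimately show "linear_code n k C" by simp
qed (rule linear_code_generated)

text \<open>
  In terms of the generator matrix \<open>G\<close>: the matrix \<open>G * G\<^sup>T\<close> is invertible.
\<close>
definition nondegenerate :: "nat \<Rightarrow> 'a :: field vec multiset \<Rightarrow> bool" where
  "nondegenerate k M \<longleftrightarrow>
    (\<forall>u\<in>carrier_vec k. (\<forall>w\<in>carrier_vec k. gram M u w = 0) \<longrightarrow> u = 0\<^sub>v k)"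

definition has_min_wt :: "nat \<Rightarrow> nat \<Rightarrow> 'a :: field vec multiset \<Rightarrow> bool" where
  "has_min_wt k d M \<longleftrightarrow> (\<forall>u\<in>carrier_vec k - {0\<^sub>v k}. d \<le> wt M u) \<and>
    (\<exists>u\<in>carrier_vec k - {0\<^sub>v k}. wt M u = d)"

text \<open>
  A message with codeword 0 lies in the radical of the Gram form, so nondegeneracy includes full rank.
\<close>
lemma nondegenerate_inj_codeword:
  assumes G: "set G \<subseteq> carrier_vec k" and nd: "nondegenerate k (mset G)"
  shows "inj_on (codeword G) (carrier_vec k)"
  unfolding inj_codeword_iff[OF G]
proof (intro ballI impI)
  fix u :: "'a vec" assume u: "u \<in> carrier_vec k" and z: "codeword G u = 0\<^sub>v (length G)"
  have "gram (mset G) u w = 0" for w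
    unfolding scalar_prod_codeword[symmetric] z by simp
  then show "u = 0\<^sub>v k" using nd u by (auto simp: nondegenerate_def)
qed

lemma LCD_generated_code_iff:
  assumes G: "set G \<subseteq> carrier_vec k" and inj: "inj_on (codeword G) (carrier_vec k)"
  shows "LCD (length G) (generated_code k G) \<longleftrightarrow> nondegenerate k (mset G)"
proof -
  have zero: "0\<^sub>v (length G) \<in> generated_code k G \<inter> dual_code (length G) (generated_code k G)"
    using imageI[of "0\<^sub>v k" "carrier_vec k" "codeword G"] codeword_zero[OF G]
    by (auto simp: generated_code_def vec_module.orthogonal_complement_def)
  have dual: "codeword G u \<in> dual_code (length G) (generated_code k G) \<longleftrightarrow>
      (\<forall>w\<in>carrier_vec k. gram (mset G) u w = 0)" for u
    by (simp add: vec_module.orthogonal_complement_def generated_code_def scalar_prod_codeword)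
  have "LCD (length G) (generated_code k G) \<longleftrightarrow>
      (\<forall>u\<in>carrier_vec k. codeword G u \<in> dual_code (length G) (generated_code k G) \<longrightarrow>
        codeword G u = 0\<^sub>v (length G))"
    unfolding LCD_def using zero by (auto simp: generated_code_def)
  then show ?thesis
    using inj codeword_zero[OF G] unfolding dual nondegenerate_def inj_codeword_iff[OF G] by metis
qed

lemma INF_enat_eq_iff:
  "(INF x\<in>A. enat (f x)) = enat d \<longleftrightarrow> (\<forall>x\<in>A. d \<le> f x) \<and> (\<exists>x\<in>A. f x = d)"
proof
  assume e: "(INF x\<in>A. enat (f x)) = enat d"
  have "\<forall>x\<in>A. d \<le> f x" using INF_lower[of _ A "\<lambda>x. enat (f x)"] e by auto
  moreover have "\<exists>x\<in>A. f x = d"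
  proof (rule ccontr)
    assume "\<not> (\<exists>x\<in>A. f x = d)"
    with \<open>\<forall>x\<in>A. d \<le> f x\<close> have "\<forall>x\<in>A. Suc d \<le> f x" by (metis Suc_leI le_neq_implies_less)
    then have "enat (Suc d) \<le> (INF x\<in>A. enat (f x))" by (intro INF_greatest) auto
    then show False using e by simp
  qed
  ultimately show "(\<forall>x\<in>A. d \<le> f x) \<and> (\<exists>x\<in>A. f x = d)" by blast
next
  assume a: "(\<forall>x\<in>A. d \<le> f x) \<and> (\<exists>x\<in>A. f x = d)"
  show "(INF x\<in>A. enat (f x)) = enat d"
  proof (rule antisym)
    show "(INF x\<in>A. enat (f x)) \<le> enat d" using a by (auto intro: INF_lower2)
    show "enat d \<le> (INF x\<in>A. enat (f x))" using a by (auto intro: INF_greatest)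
  qed
qed

lemma min_weight_generated_code:
  assumes G: "set G \<subseteq> carrier_vec k" and inj: "inj_on (codeword G) (carrier_vec k)"
  shows "min_weight (length G) (generated_code k G) = enat d \<longleftrightarrow> has_min_wt k d (mset G)"
proof -
  have "generated_code k G - {0\<^sub>v (length G)} = codeword G ` (carrier_vec k - {0\<^sub>v k})"
    using inj codeword_zero[OF G] unfolding inj_codeword_iff[OF G] by (auto simp: generated_code_def)
  then show ?thesis
    by (simp add: min_weight_def INF_enat_eq_iff hamming_weight_codeword has_min_wt_def)
qed

text \<open>
  A dual codeword of weight one is a multiple of a unit vector, and such a vector is orthogonal to the
  code exactly if the corresponding column vanishes.
\<close>
lemma dual_distance_generated_code:
  fixes G :: "'a :: field vec list"
  assumes G: "set G \<subseteq> carrier_vec k"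
  shows "dual_distance (length G) (generated_code k G) \<ge> 2 \<longleftrightarrow> 0\<^sub>v k \<notin> set G"
proof -
  let ?n = "length G"
  let ?D = "dual_code ?n (generated_code k G)"
  have D: "x \<in> ?D \<longleftrightarrow> x \<in> carrier_vec ?n \<and> (\<forall>u\<in>carrier_vec k. x \<bullet> codeword G u = 0)" for x
    by (auto simp: vec_module.orthogonal_complement_def generated_code_def)
  have two: "(2 :: enat) = enat 2" by (simp add: numeral_eq_enat)
  have "dual_distance ?n (generated_code k G) \<ge> 2 \<longleftrightarrow> (\<forall>x\<in>?D - {0\<^sub>v ?n}. 2 \<le> hamming_weight x)"
    unfolding dual_distance_def min_weight_def le_INF_iff two by simp
  also have "\<dots> \<longleftrightarrow> 0\<^sub>v k \<notin> set G"
  proof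
    assume h: "\<forall>x\<in>?D - {0\<^sub>v ?n}. 2 \<le> hamming_weight x"
    show "0\<^sub>v k \<notin> set G"
    proof
      assume "0\<^sub>v k \<in> set G"
      then obtain i where i: "i < ?n" "G ! i = 0\<^sub>v k" by (auto simp: in_set_conv_nth)
      then have "unit_vec ?n i \<in> ?D" unfolding D by (auto simp: codeword_def)
      moreover have "{j. j < dim_vec (unit_vec ?n i :: 'a vec) \<and> (unit_vec ?n i :: 'a vec) $ j \<noteq> 0} = {i}"
        using i by (auto split: if_splits)
      then have "hamming_weight (unit_vec ?n i :: 'a vec) = 1" by (simp add: hamming_weight_def)
      moreover have "unit_vec ?n i \<noteq> 0\<^sub>v ?n" using i by simp
      ultimately show False using bspec[OF h, of "unit_vec ?n i"] by simp
    qed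
  next
    assume nz: "0\<^sub>v k \<notin> set G"
    show "\<forall>x\<in>?D - {0\<^sub>v ?n}. 2 \<le> hamming_weight x"
    proof (rule ccontr)
      assume "\<not> (\<forall>x\<in>?D - {0\<^sub>v ?n}. 2 \<le> hamming_weight x)"
      then obtain x where x: "x \<in> ?D" "x \<noteq> 0\<^sub>v ?n" and w: "hamming_weight x < 2"
        by (auto simp: not_le)
      have xc: "x \<in> carrier_vec ?n" using x D by simp
      then obtain i where i: "i < ?n" "x $ i \<noteq> 0"
        using x(2) by (metis carrier_vecD eq_vecI index_zero_vec)
      let ?S = "{j. j < dim_vec x \<and> x $ j \<noteq> 0}"
      have "{i} = ?S"
      proof (rule card_subset_eq)
        show sub: "{i} \<subseteq> ?S" using i xc by auto
        have "card {i} \<le> card ?S" by (rule card_mono[OF _ sub]) simp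
        then show "card {i} = card ?S" using w by (simp add: hamming_weight_def)
      qed simp
      then have supp: "x $ j = 0" if "j < ?n" "j \<noteq> i" for j using that xc by auto
      have "x \<bullet> codeword G u = x $ i * (u \<bullet> G ! i)" for u
      proof -
        have "x \<bullet> codeword G u = (\<Sum>j\<in>{0..<?n}. x $ j * (u \<bullet> G ! j))"
          by (simp add: scalar_prod_def codeword_def)
        also have "\<dots> = (\<Sum>j\<in>{i}. x $ j * (u \<bullet> G ! j))"
          by (rule sum.mono_neutral_right) (use i supp in auto)
        finally show ?thesis by simp
      qed
      then have "u \<bullet> G ! i = 0" if "u \<in> carrier_vec k" for u
        using x(1) that i unfolding D by auto
      then have "G ! i = 0\<^sub>v k"
        using scalar_prod_separates[OF nth_carrier[OF G i(1)]] by force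
      then show False using nz i by (metis nth_mem)
    qed
  qed
  finally show ?thesis .
qed

lemma LCD_codes_iff:
  fixes C :: "'a :: {field, finite} vec set"
  shows "C \<in> LCD_codes n k d \<longleftrightarrow> (\<exists>G. length G = n \<and> set G \<subseteq> carrier_vec k \<and>
    nondegenerate k (mset G) \<and> has_min_wt k d (mset G) \<and> C = generated_code k G)"
proof
  assume "C \<in> LCD_codes n k d"
  then have C: "linear_code n k C" "min_weight n C = enat d" "LCD n C"
    by (auto simp: LCD_codes_def linear_code_dist_def)
  obtain G where G: "length G = n" "set G \<subseteq> carrier_vec k"
    "inj_on (codeword G) (carrier_vec k)" "C = generated_code k G"
    using linear_code_generated[OF C(1)] by blast
  show "\<exists>G. length G = n \<and> set G \<subseteq> carrier_vec k \<and> nondegenerate k (mset G) \<and>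
      has_min_wt k d (mset G) \<and> C = generated_code k G"
    using G C(2,3) LCD_generated_code_iff[OF G(2,3)] min_weight_generated_code[OF G(2,3)] by blast
next
  assume "\<exists>G. length G = n \<and> set G \<subseteq> carrier_vec k \<and> nondegenerate k (mset G) \<and>
      has_min_wt k d (mset G) \<and> C = generated_code k G"
  then obtain G where G: "length G = n" "set G \<subseteq> carrier_vec k" "nondegenerate k (mset G)"
      "has_min_wt k d (mset G)" "C = generated_code k G" by blast
  note inj = nondegenerate_inj_codeword[OF G(2,3)]
  show "C \<in> LCD_codes n k d"
    unfolding LCD_codes_def linear_code_dist_def linear_code_iff_generated
    using G inj LCD_generated_code_iff[OF G(2) inj] min_weight_generated_code[OF G(2) inj] by blast
qed

lemma LCD_codes_dual2_iff:
  fixes C :: "'a :: {field, finite} vec set"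
  shows "C \<in> LCD_codes_dual2 n k d \<longleftrightarrow> (\<exists>G. length G = n \<and> set G \<subseteq> carrier_vec k - {0\<^sub>v k} \<and>
    nondegenerate k (mset G) \<and> has_min_wt k d (mset G) \<and> C = generated_code k G)"
proof
  assume "C \<in> LCD_codes_dual2 n k d"
  then have C: "C \<in> LCD_codes n k d" "2 \<le> dual_distance n C"
    by (auto simp: LCD_codes_dual2_def)
  obtain G where G: "length G = n" "set G \<subseteq> carrier_vec k" "nondegenerate k (mset G)"
      "has_min_wt k d (mset G)" "C = generated_code k G" using C(1) unfolding LCD_codes_iff by blast
  show "\<exists>G. length G = n \<and> set G \<subseteq> carrier_vec k - {0\<^sub>v k} \<and> nondegenerate k (mset G) \<and>
      has_min_wt k d (mset G) \<and> C = generated_code k G"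
    using G C(2) dual_distance_generated_code[OF G(2)] by blast
next
  assume "\<exists>G. length G = n \<and> set G \<subseteq> carrier_vec k - {0\<^sub>v k} \<and> nondegenerate k (mset G) \<and>
      has_min_wt k d (mset G) \<and> C = generated_code k G"
  then obtain G where G: "length G = n" "set G \<subseteq> carrier_vec k - {0\<^sub>v k}"
      "nondegenerate k (mset G)" "has_min_wt k d (mset G)" "C = generated_code k G" by blast
  then have "C \<in> LCD_codes n k d" unfolding LCD_codes_iff by blast
  moreover have "2 \<le> dual_distance n C"
    using G(1,2,5) dual_distance_generated_code[of G k] by auto
  ultimately show "C \<in> LCD_codes_dual2 n k d" by (simp add: LCD_codes_dual2_def)
qed

section \<open>Equivalence of codes\<close>

definition lin_aut :: "nat \<Rightarrow> ('a :: field vec \<Rightarrow> 'a vec) \<Rightarrow> bool" where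
  "lin_aut k \<psi> \<longleftrightarrow> bij_betw \<psi> (carrier_vec k) (carrier_vec k) \<and>
    (\<forall>u\<in>carrier_vec k. \<forall>w\<in>carrier_vec k. \<psi> (u + w) = \<psi> u + \<psi> w) \<and>
    (\<forall>a. \<forall>u\<in>carrier_vec k. \<psi> (a \<cdot>\<^sub>v u) = a \<cdot>\<^sub>v \<psi> u)"

lemma lin_aut_carrier: "lin_aut k \<psi> \<Longrightarrow> u \<in> carrier_vec k \<Longrightarrow> \<psi> u \<in> carrier_vec k"
  and lin_aut_add: "lin_aut k \<psi> \<Longrightarrow> u \<in> carrier_vec k \<Longrightarrow> w \<in> carrier_vec k \<Longrightarrow> \<psi> (u + w) = \<psi> u + \<psi> w"
  and lin_aut_smult: "lin_aut k \<psi> \<Longrightarrow> u \<in> carrier_vec k \<Longrightarrow> \<psi> (a \<cdot>\<^sub>v u) = a \<cdot>\<^sub>v \<psi> u"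
  and lin_aut_bij: "lin_aut k \<psi> \<Longrightarrow> bij_betw \<psi> (carrier_vec k) (carrier_vec k)"
  by (auto simp: lin_aut_def bij_betw_def)

lemma lin_aut_zero:
  fixes \<psi> :: "'a :: field vec \<Rightarrow> 'a vec"
  assumes "lin_aut k \<psi>"
  shows "\<psi> (0\<^sub>v k) = 0\<^sub>v k"
proof -
  have zero: "0 \<cdot>\<^sub>v v = 0\<^sub>v k" if "v \<in> carrier_vec k" for v :: "'a vec"
    using that by (intro eq_vecI) auto
  show ?thesis
    using lin_aut_smult[OF assms, of "0\<^sub>v k" 0] lin_aut_carrier[OF assms, of "0\<^sub>v k"] by (simp only: zero zero_carrier_vec)
qed

lemma lin_aut_eq_0_iff: "lin_aut k \<psi> \<Longrightarrow> u \<in> carrier_vec k \<Longrightarrow> \<psi> u = 0\<^sub>v k \<longleftrightarrow> u = 0\<^sub>v k"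
  using lin_aut_zero[of k \<psi>] lin_aut_bij[of k \<psi>] zero_carrier_vec[of k] unfolding bij_betw_def inj_on_def
  by metis

lemma lin_aut_id: "lin_aut k (\<lambda>u. u)"
  by (simp add: lin_aut_def bij_betw_def)

lemma lin_aut_comp: "lin_aut k \<phi> \<Longrightarrow> lin_aut k \<psi> \<Longrightarrow> lin_aut k (\<lambda>u. \<phi> (\<psi> u))"
  using bij_betw_trans[of \<psi> "carrier_vec k" "carrier_vec k" \<phi> "carrier_vec k"] lin_aut_carrier[of k \<psi>]
  by (simp add: lin_aut_def o_def)

lemma lin_autI:
  fixes \<psi> :: "'a :: {field, finite} vec \<Rightarrow> 'a vec"
  assumes "\<And>u. u \<in> carrier_vec k \<Longrightarrow> \<psi> u \<in> carrier_vec k"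
    and "inj_on \<psi> (carrier_vec k)"
    and "\<And>u w. u \<in> carrier_vec k \<Longrightarrow> w \<in> carrier_vec k \<Longrightarrow> \<psi> (u + w) = \<psi> u + \<psi> w"
    and "\<And>a u. u \<in> carrier_vec k \<Longrightarrow> \<psi> (a \<cdot>\<^sub>v u) = a \<cdot>\<^sub>v \<psi> u"
  shows "lin_aut k \<psi>"
proof -
  have "\<psi> ` carrier_vec k = carrier_vec k"
    using assms(1,2) by (intro endo_inj_surj) (auto simp: finite_carrier_vec)
  then show ?thesis using assms by (simp add: lin_aut_def bij_betw_def)
qed

lemma lin_aut_inverse:
  fixes \<psi> :: "'a :: {field, finite} vec \<Rightarrow> 'a vec"
  assumes \<psi>: "lin_aut k \<psi>"
  shows "\<exists>\<phi>. lin_aut k \<phi> \<and> (\<forall>u\<in>carrier_vec k. \<phi> (\<psi> u) = u)"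
proof -
  define \<phi> where "\<phi> = the_inv_into (carrier_vec k) \<psi>"
  have inj: "inj_on \<psi> (carrier_vec k)" and im: "\<psi> ` carrier_vec k = carrier_vec k"
    using lin_aut_bij[OF \<psi>] by (auto simp: bij_betw_def)
  have inv: "\<phi> (\<psi> u) = u" if "u \<in> carrier_vec k" for u
    unfolding \<phi>_def using the_inv_into_f_f[OF inj that] .
  have inv': "\<psi> (\<phi> u) = u" "\<phi> u \<in> carrier_vec k" if "u \<in> carrier_vec k" for u
    unfolding \<phi>_def using f_the_inv_into_f[OF inj] the_inv_into_into[OF inj] that im by auto
  have "lin_aut k \<phi>"
  proof (rule lin_autI)
    show "inj_on \<phi> (carrier_vec k)" using inv' by (metis inj_onI)
    show "\<phi> (u + w) = \<phi> u + \<phi> w" if "u \<in> carrier_vec k" "w \<in> carrier_vec k" for u w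
      using inv[of "\<phi> u + \<phi> w"] lin_aut_add[OF \<psi>, of "\<phi> u" "\<phi> w"] inv' that by simp
    show "\<phi> (a \<cdot>\<^sub>v u) = a \<cdot>\<^sub>v \<phi> u" if "u \<in> carrier_vec k" for a u
      using inv[of "a \<cdot>\<^sub>v \<phi> u"] lin_aut_smult[OF \<psi>, of "\<phi> u" a] inv' that by simp
  qed (rule inv')
  then show ?thesis using inv by blast
qed

text \<open>
  The vector \<open>v\<close> is built up coordinate by coordinate.
\<close>
lemma linear_functional_scalar_prod:
  fixes L :: "'a :: field vec \<Rightarrow> 'a"
  assumes add: "\<And>v w. v \<in> carrier_vec k \<Longrightarrow> w \<in> carrier_vec k \<Longrightarrow> L (v + w) = L v + L w"
    and smult: "\<And>a v. v \<in> carrier_vec k \<Longrightarrow> L (a \<cdot>\<^sub>v v) = a * L v"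
    and v: "v \<in> carrier_vec k"
  shows "L v = vec k (\<lambda>i. L (unit_vec k i)) \<bullet> v"
proof -
  define t where "t m = vec k (\<lambda>i. if i < m then v $ i else 0)" for m
  have "L (t m) = (\<Sum>i<m. L (unit_vec k i) * v $ i)" if "m \<le> k" for m
    using that
  proof (induction m)
    case 0
    have "t 0 = 0 \<cdot>\<^sub>v 0\<^sub>v k" by (rule eq_vecI) (auto simp: t_def)
    then show ?case using smult[of "0\<^sub>v k" 0] by simp
  next
    case (Suc m)
    have "t (Suc m) = t m + v $ m \<cdot>\<^sub>v unit_vec k m"
      using Suc.prems by (intro eq_vecI) (auto simp: t_def less_Suc_eq)
    then have "L (t (Suc m)) = L (t m) + v $ m * L (unit_vec k m)"
      using add[of "t m" "v $ m \<cdot>\<^sub>v unit_vec k m"] smult[of "unit_vec k m" "v $ m"] by (simp add: t_def)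
    then show ?case using Suc by (simp add: mult.commute)
  qed
  from this[of k] have "L (t k) = (\<Sum>i<k. L (unit_vec k i) * v $ i)" by simp
  moreover have "t k = v" using v by (intro eq_vecI) (auto simp: t_def)
  ultimately show ?thesis using v by (simp add: scalar_prod_def atLeast0LessThan)
qed

text \<open>
  The adjoint translates between a change of the messages and a change of the columns of a code.
\<close>
lemma lin_aut_adjoint:
  fixes \<psi> :: "'a :: {field, finite} vec \<Rightarrow> 'a vec"
  assumes \<psi>: "lin_aut k \<psi>"
  shows "\<exists>\<phi>. lin_aut k \<phi> \<and> (\<forall>u\<in>carrier_vec k. \<forall>v\<in>carrier_vec k. u \<bullet> \<psi> v = \<phi> u \<bullet> v)"
proof -
  define \<phi> where "\<phi> u = vec k (\<lambda>i. u \<bullet> \<psi> (unit_vec k i))" for u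
  note c = lin_aut_carrier[OF \<psi>]
  have adj: "u \<bullet> \<psi> v = \<phi> u \<bullet> v" if "u \<in> carrier_vec k" "v \<in> carrier_vec k" for u v
    unfolding \<phi>_def using that c
    by (intro linear_functional_scalar_prod)
      (auto simp: lin_aut_add[OF \<psi>] lin_aut_smult[OF \<psi>] scalar_prod_add_distrib[of _ k]
        scalar_prod_smult_distrib[of _ k])
  have "lin_aut k \<phi>"
  proof (rule lin_autI)
    show "inj_on \<phi> (carrier_vec k)"
    proof (rule inj_onI)
      fix u w :: "'a vec" assume u: "u \<in> carrier_vec k" and w: "w \<in> carrier_vec k" and e: "\<phi> u = \<phi> w"
      have "u $ i = w $ i" if i: "i < k" for i
      proof -
        obtain v where v: "v \<in> carrier_vec k" "\<psi> v = unit_vec k i"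
          using lin_aut_bij[OF \<psi>] unit_vec_carrier[of k i] by (metis bij_betw_imp_surj_on imageE)
        then show ?thesis using adj[OF u v(1)] adj[OF w v(1)] e u w i by simp
      qed
      then show "u = w" using u w by (intro eq_vecI) auto
    qed
    show "\<phi> (u + w) = \<phi> u + \<phi> w" if "u \<in> carrier_vec k" "w \<in> carrier_vec k" for u w
      using that c by (intro eq_vecI) (auto simp: \<phi>_def add_scalar_prod_distrib[of _ k])
    show "\<phi> (a \<cdot>\<^sub>v u) = a \<cdot>\<^sub>v \<phi> u" if "u \<in> carrier_vec k" for a u
      using that c by (intro eq_vecI) (auto simp: \<phi>_def smult_scalar_prod_distrib[of _ k])
  qed (simp add: \<phi>_def)
  then show ?thesis using adj by blast
qed

lemma rep_lin_aut:
  assumes "lin_aut k \<psi>" "v \<in> carrier_vec k"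
  shows "rep (\<psi> (rep v)) = rep (\<psi> v)"
proof -
  obtain a where a: "a \<noteq> 0" "rep v = a \<cdot>\<^sub>v v" using rep_smult by blast
  show ?thesis unfolding a(2) using lin_aut_smult[OF assms] rep_of_smult[OF a(1)] by simp
qed

lemma image_rep_lin_aut:
  assumes "lin_aut k \<psi>" "set_mset M \<subseteq> carrier_vec k"
  shows "image_mset (\<lambda>v. rep (\<psi> v)) (image_mset rep M) = image_mset (\<lambda>v. rep (\<psi> v)) M"
  using assms by (auto simp: image_mset.compositionality intro!: image_mset_cong rep_lin_aut)

lemma simplex_lin_aut:
  fixes \<psi> :: "'a :: {field, finite} vec \<Rightarrow> 'a vec"
  assumes \<psi>: "lin_aut k \<psi>"
  shows "image_mset (\<lambda>v. rep (\<psi> v)) (simplex k) = simplex k"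
proof -
  have into: "(\<lambda>v. rep (\<psi> v)) ` points k \<subseteq> points k"
  proof safe
    fix p :: "'a vec" assume "p \<in> points k"
    then have "p \<in> carrier_vec k" "p \<noteq> 0\<^sub>v k" using points_carrier zero_notin_points by auto
    then show "rep (\<psi> p) \<in> points k"
      using rep_in_points_iff lin_aut_carrier[OF \<psi>] lin_aut_eq_0_iff[OF \<psi>] by metis
  qed
  have inj: "inj_on (\<lambda>v. rep (\<psi> v)) (points k)"
  proof (rule inj_onI)
    fix p p' assume p: "p \<in> points k" "p' \<in> points k" and "rep (\<psi> p) = rep (\<psi> p')"
    then obtain a where a: "a \<noteq> 0" "\<psi> p' = a \<cdot>\<^sub>v \<psi> p" unfolding rep_eq_iff by blast
    have c: "p \<in> carrier_vec k" "p' \<in> carrier_vec k" using p points_carrier by auto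
    have "\<psi> p' = \<psi> (a \<cdot>\<^sub>v p)" using a(2) lin_aut_smult[OF \<psi> c(1)] by simp
    then have "p' = a \<cdot>\<^sub>v p" using lin_aut_bij[OF \<psi>] c by (auto simp: bij_betw_def inj_on_def)
    then show "p = p'" using points_not_smult[OF p] by blast
  qed
  have "(\<lambda>v. rep (\<psi> v)) ` points k = points k"
    using endo_inj_surj[OF finite_points into inj] .
  then show ?thesis by (simp add: image_mset_mset_set[OF inj])
qed

lemma mult_transpose_vec_index:
  assumes "P \<in> carrier_mat n n" "c \<in> carrier_vec n" "j < n"
  shows "(P\<^sup>T *\<^sub>v c) $ j = (\<Sum>i<n. P $$ (i, j) * c $ i)"
  using assms by (simp add: scalar_prod_def atLeast0LessThan)

lemma sum_single_support:
  assumes "finite A" "s \<in> A" "\<And>i. i \<in> A \<Longrightarrow> i \<noteq> s \<Longrightarrow> f i = 0"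
  shows "(\<Sum>i\<in>A. f i * g i) = f s * (g s :: 'a :: semiring_0)"
proof -
  have "(\<Sum>i\<in>A. f i * g i) = (\<Sum>i\<in>{s}. f i * g i)"
    by (rule sum.mono_neutral_right) (use assms in auto)
  then show ?thesis by simp
qed

lemma monomial_mat_permutation:
  assumes P: "monomial_mat n P"
  shows "\<exists>\<sigma>. bij_betw \<sigma> {..<n} {..<n} \<and> (\<forall>j<n. P $$ (\<sigma> j, j) \<noteq> 0 \<and> (\<forall>i<n. i \<noteq> \<sigma> j \<longrightarrow> P $$ (i, j) = 0))"
proof -
  have "\<forall>j. \<exists>i. j < n \<longrightarrow> i < n \<and> P $$ (i, j) \<noteq> 0 \<and> (\<forall>i'<n. i' \<noteq> i \<longrightarrow> P $$ (i', j) = 0)"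
    using P unfolding monomial_mat_def by metis
  then obtain \<sigma> where \<sigma>: "\<And>j. j < n \<Longrightarrow> \<sigma> j < n \<and> P $$ (\<sigma> j, j) \<noteq> 0 \<and> (\<forall>i'<n. i' \<noteq> \<sigma> j \<longrightarrow> P $$ (i', j) = 0)"
    by metis
  have "inj_on \<sigma> {..<n}"
  proof (rule inj_onI)
    fix j j' assume j: "j \<in> {..<n}" "j' \<in> {..<n}" "\<sigma> j = \<sigma> j'"
    then have "\<sigma> j < n" using \<sigma> by simp
    then have "\<exists>!l. l < n \<and> P $$ (\<sigma> j, l) \<noteq> 0" using P unfolding monomial_mat_def by simp
    moreover have "P $$ (\<sigma> j, j) \<noteq> 0" "P $$ (\<sigma> j, j') \<noteq> 0" using \<sigma>[of j] \<sigma>[of j'] j by auto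
    ultimately show "j = j'" using j by blast
  qed
  then have "bij_betw \<sigma> {..<n} {..<n}"
    using \<sigma> endo_inj_surj[of "{..<n}" \<sigma>] by (auto simp: bij_betw_def)
  then show ?thesis using \<sigma> by blast
qed

text \<open>
  Two generator matrices of the same code differ by a change of the messages \<open>\<phi>\<close>; its adjoint maps the
  columns of one matrix to those of the other.
\<close>
lemma generated_code_lin_aut:
  fixes G H :: "'a :: {field, finite} vec list"
  assumes G: "set G \<subseteq> carrier_vec k" and H: "set H \<subseteq> carrier_vec k" and len: "length G = length H"
    and injH: "inj_on (codeword H) (carrier_vec k)"
    and eq: "generated_code k G = generated_code k H"
  shows "\<exists>\<psi>. lin_aut k \<psi> \<and> H = map \<psi> G"
proof -
  have "card (codeword G ` carrier_vec k) = card (carrier_vec k :: 'a vec set)"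
    using eq card_image[OF injH] by (simp add: generated_code_def)
  then have injG: "inj_on (codeword G) (carrier_vec k)"
    by (intro eq_card_imp_inj_on) (auto simp: finite_carrier_vec)
  define \<phi> where "\<phi> u = the_inv_into (carrier_vec k) (codeword G) (codeword H u)" for u
  have \<phi>: "\<phi> u \<in> carrier_vec k" "codeword G (\<phi> u) = codeword H u" if "u \<in> carrier_vec k" for u
  proof -
    have "codeword H u \<in> codeword G ` carrier_vec k" using eq that by (auto simp: generated_code_def)
    then show "\<phi> u \<in> carrier_vec k" "codeword G (\<phi> u) = codeword H u"
      unfolding \<phi>_def using the_inv_into_into[OF injG] f_the_inv_into_f[OF injG] by auto
  qed
  have \<phi>_eqI: "\<phi> u = w" if "u \<in> carrier_vec k" "w \<in> carrier_vec k" "codeword G w = codeword H u" for u w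
    using inj_onD[OF injG, of "\<phi> u" w] \<phi>[OF that(1)] that by simp
  have "lin_aut k \<phi>"
  proof (rule lin_autI)
    show "inj_on \<phi> (carrier_vec k)"
      using \<phi> injH unfolding inj_on_def by metis
    show "\<phi> (u + w) = \<phi> u + \<phi> w" if "u \<in> carrier_vec k" "w \<in> carrier_vec k" for u w
      using that \<phi> by (intro \<phi>_eqI) (auto simp: codeword_add[OF G] codeword_add[OF H])
    show "\<phi> (a \<cdot>\<^sub>v u) = a \<cdot>\<^sub>v \<phi> u" if "u \<in> carrier_vec k" for a u
      using that \<phi> by (intro \<phi>_eqI) (auto simp: codeword_smult[OF G] codeword_smult[OF H])
  qed (rule \<phi>)
  then obtain \<psi> where \<psi>: "lin_aut k \<psi>"
    and adj: "\<And>u v. u \<in> carrier_vec k \<Longrightarrow> v \<in> carrier_vec k \<Longrightarrow> u \<bullet> \<phi> v = \<psi> u \<bullet> v"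
    using lin_aut_adjoint by blast
  have "H ! i = \<psi> (G ! i)" if i: "i < length G" for i
  proof (rule eq_vecI)
    have Gi: "G ! i \<in> carrier_vec k" and Hi: "H ! i \<in> carrier_vec k" using G H i len nth_carrier by metis+
    show "dim_vec (H ! i) = dim_vec (\<psi> (G ! i))" using Hi lin_aut_carrier[OF \<psi> Gi] by simp
    fix j assume "j < dim_vec (\<psi> (G ! i))"
    then have j: "j < k" using lin_aut_carrier[OF \<psi> Gi] by simp
    let ?e = "unit_vec k j :: 'a vec"
    have e: "?e \<in> carrier_vec k" by simp
    have "H ! i $ j = ?e \<bullet> H ! i" using j Hi by simp
    also have "\<dots> = codeword H ?e $ i" using i len by (simp add: codeword_def)
    also have "\<dots> = codeword G (\<phi> ?e) $ i" using \<phi>(2)[OF e] by simp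
    also have "\<dots> = \<phi> ?e \<bullet> G ! i" using i by (simp add: codeword_def)
    also have "\<dots> = G ! i \<bullet> \<phi> ?e" by (rule comm_scalar_prod[OF \<phi>(1)[OF e] Gi])
    also have "\<dots> = \<psi> (G ! i) \<bullet> ?e" by (rule adj[OF Gi e])
    also have "\<dots> = \<psi> (G ! i) $ j" using j by simp
    finally show "H ! i $ j = \<psi> (G ! i) $ j" .
  qed
  then have "H = map \<psi> G" using len by (intro nth_equalityI) auto
  then show ?thesis using \<psi> by blast
qed

text \<open>
  A monomial matrix permutes the columns and multiplies them with nonzero scalars, which does not change the
  multiset of points.
\<close>
lemma monomial_image_generated_code:
  fixes G :: "'a :: {field, finite} vec list"
  assumes G: "set G \<subseteq> carrier_vec k" and P: "monomial_mat (length G) P"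
  shows "\<exists>H. length H = length G \<and> set H \<subseteq> carrier_vec k \<and>
    image_mset rep (mset H) = image_mset rep (mset G) \<and>
    (\<lambda>c. P\<^sup>T *\<^sub>v c) ` generated_code k G = generated_code k H"
proof -
  let ?n = "length G"
  obtain \<sigma> where bij: "bij_betw \<sigma> {..<?n} {..<?n}"
    and \<sigma>: "\<And>j. j < ?n \<Longrightarrow> P $$ (\<sigma> j, j) \<noteq> 0 \<and> (\<forall>i<?n. i \<noteq> \<sigma> j \<longrightarrow> P $$ (i, j) = 0)"
    using monomial_mat_permutation[OF P] by blast
  have Pc: "P \<in> carrier_mat ?n ?n" using P by (simp add: monomial_mat_def)
  have \<sigma>n: "\<sigma> j < ?n" if "j < ?n" for j using bij that by (auto simp: bij_betw_def)
  define H where "H = map (\<lambda>j. P $$ (\<sigma> j, j) \<cdot>\<^sub>v G ! \<sigma> j) [0..<?n]"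
  have len: "length H = ?n" by (simp add: H_def)
  have Hc: "set H \<subseteq> carrier_vec k"
    using \<sigma>n nth_carrier[OF G] by (auto simp: H_def)
  have cw: "P\<^sup>T *\<^sub>v codeword G u = codeword H u" if u: "u \<in> carrier_vec k" for u
  proof (rule eq_vecI)
    show "dim_vec (P\<^sup>T *\<^sub>v codeword G u) = dim_vec (codeword H u)"
      using Pc len by (simp add: codeword_def)
    fix j assume "j < dim_vec (codeword H u)"
    then have j: "j < ?n" using len by (simp add: codeword_def)
    have "(P\<^sup>T *\<^sub>v codeword G u) $ j = (\<Sum>i<?n. P $$ (i, j) * codeword G u $ i)"
      by (rule mult_transpose_vec_index[OF Pc codeword_carrier j])
    also have "\<dots> = P $$ (\<sigma> j, j) * codeword G u $ \<sigma> j"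
      by (rule sum_single_support) (use \<sigma>[OF j] \<sigma>n[OF j] in auto)
    also have "\<dots> = codeword H u $ j"
      using j \<sigma>n[OF j] nth_carrier[OF G \<sigma>n[OF j]] u len by (simp add: codeword_def H_def)
    finally show "(P\<^sup>T *\<^sub>v codeword G u) $ j = codeword H u $ j" .
  qed
  have "image_mset rep (mset H) = image_mset (\<lambda>j. rep (P $$ (\<sigma> j, j) \<cdot>\<^sub>v G ! \<sigma> j)) (mset_set {..<?n})"
    by (simp add: H_def image_mset.compositionality o_def atLeast0LessThan)
  also have "\<dots> = image_mset (\<lambda>j. rep (G ! \<sigma> j)) (mset_set {..<?n})"
    using \<sigma> by (intro image_mset_cong rep_of_smult) auto
  also have "\<dots> = image_mset (\<lambda>j. rep (G ! j)) (image_mset \<sigma> (mset_set {..<?n}))"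
    by (simp add: image_mset.compositionality o_def)
  also have "image_mset \<sigma> (mset_set {..<?n}) = mset_set {..<?n}"
    using bij by (simp add: image_mset_mset_set bij_betw_def)
  also have "image_mset (\<lambda>j. rep (G ! j)) (mset_set {..<?n}) = image_mset rep (mset (map ((!) G) [0..<?n]))"
    by (simp add: image_mset.compositionality o_def atLeast0LessThan)
  also have "\<dots> = image_mset rep (mset G)" by (simp only: map_nth)
  finally have "image_mset rep (mset H) = image_mset rep (mset G)" .
  moreover have "(\<lambda>c. P\<^sup>T *\<^sub>v c) ` generated_code k G = generated_code k H"
    using cw by (auto simp: generated_code_def image_image)
  ultimately show ?thesis using len Hc by blast
qed

text \<open>
  Equal multisets of points provide a permutation of the columns and a nonzero scalar for each of them;
  these are the entries of the monomial matrix.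
\<close>
lemma monomial_mat_of_rep_eq:
  fixes G H :: "'a :: {field, finite} vec list"
  assumes G: "set G \<subseteq> carrier_vec k" and H: "set H \<subseteq> carrier_vec k"
    and eq: "image_mset rep (mset H) = image_mset rep (mset G)"
  shows "\<exists>P. monomial_mat (length G) P \<and> (\<lambda>c. P\<^sup>T *\<^sub>v c) ` generated_code k G = generated_code k H"
proof -
  let ?n = "length G"
  have len: "length H = ?n" using arg_cong[OF eq, of size] by simp
  have "mset (map rep H) = mset (map rep G)" using eq by simp
  then obtain \<sigma> where perm: "\<sigma> permutes {..<?n}" and pl: "permute_list \<sigma> (map rep G) = map rep H"
    by (metis mset_eq_permutation length_map)
  have \<sigma>n: "\<sigma> j < ?n" if "j < ?n" for j using permutes_in_image[OF perm, of j] that by simp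
  have inj: "inj \<sigma>" using permutes_inj[OF perm] .
  have "rep (G ! \<sigma> j) = rep (H ! j)" if j: "j < ?n" for j
    using arg_cong[OF pl, of "\<lambda>l. l ! j"] permute_list_nth[of \<sigma> "map rep G" j] perm j \<sigma>n[OF j] len by simp
  then have "\<exists>a. a \<noteq> 0 \<and> H ! j = a \<cdot>\<^sub>v G ! \<sigma> j" if "j < ?n" for j
    using that rep_eq_iff by blast
  then obtain s where s: "\<And>j. j < ?n \<Longrightarrow> s j \<noteq> 0 \<and> H ! j = s j \<cdot>\<^sub>v G ! \<sigma> j" by metis
  define P where "P = mat ?n ?n (\<lambda>(i, j). if i = \<sigma> j then s j else 0)"
  have Pc: "P \<in> carrier_mat ?n ?n" by (simp add: P_def)
  have Pij: "P $$ (i, j) = (if i = \<sigma> j then s j else 0)" if "i < ?n" "j < ?n" for i j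
    using that by (simp add: P_def)
  have "monomial_mat ?n P"
    unfolding monomial_mat_def
  proof (intro conjI allI impI)
    fix i assume i: "i < ?n"
    obtain j where j: "j < ?n" "\<sigma> j = i"
      using permutes_surj[OF perm] permutes_in_image[OF perm] i by (metis lessThan_iff surjD)
    show "\<exists>!j. j < ?n \<and> P $$ (i, j) \<noteq> 0"
    proof (rule ex1I[of _ j])
      show "j < ?n \<and> P $$ (i, j) \<noteq> 0" using i j s Pij by auto
      fix j' assume j': "j' < ?n \<and> P $$ (i, j') \<noteq> 0"
      then have "i = \<sigma> j'" using Pij[OF i, of j'] by (metis (full_types))
      then show "j' = j" using injD[OF inj, of j' j] j(2) by simp
    qed
  next
    fix j assume j: "j < ?n"
    show "\<exists>!i. i < ?n \<and> P $$ (i, j) \<noteq> 0"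
    proof (rule ex1I[of _ "\<sigma> j"])
      show "\<sigma> j < ?n \<and> P $$ (\<sigma> j, j) \<noteq> 0" using j \<sigma>n s Pij by auto
      show "i = \<sigma> j" if "i < ?n \<and> P $$ (i, j) \<noteq> 0" for i
        using that j Pij by (auto split: if_splits)
    qed
  qed (rule Pc)
  moreover have "P\<^sup>T *\<^sub>v codeword G u = codeword H u" if u: "u \<in> carrier_vec k" for u
  proof (rule eq_vecI)
    show "dim_vec (P\<^sup>T *\<^sub>v codeword G u) = dim_vec (codeword H u)"
      using Pc len by (simp add: codeword_def)
    fix j assume "j < dim_vec (codeword H u)"
    then have j: "j < ?n" using len by (simp add: codeword_def)
    have "(P\<^sup>T *\<^sub>v codeword G u) $ j = (\<Sum>i<?n. P $$ (i, j) * codeword G u $ i)"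
      by (rule mult_transpose_vec_index[OF Pc codeword_carrier j])
    also have "\<dots> = P $$ (\<sigma> j, j) * codeword G u $ \<sigma> j"
      by (rule sum_single_support) (use Pij j \<sigma>n[OF j] in auto)
    also have "\<dots> = codeword H u $ j"
      using j \<sigma>n[OF j] nth_carrier[OF G \<sigma>n[OF j]] u len s[OF j] Pij[OF \<sigma>n[OF j] j]
      by (simp add: codeword_def)
    finally show "(P\<^sup>T *\<^sub>v codeword G u) $ j = codeword H u $ j" .
  qed
  then have "(\<lambda>c. P\<^sup>T *\<^sub>v c) ` generated_code k G = generated_code k H"
    by (auto simp: generated_code_def image_image)
  ultimately show ?thesis by blast
qed

lemma generated_code_map_lin_aut:
  fixes G :: "'a :: {field, finite} vec list"
  assumes \<psi>: "lin_aut k \<psi>" and G: "set G \<subseteq> carrier_vec k"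
  shows "generated_code k (map \<psi> G) = generated_code k G"
proof -
  obtain \<phi> where \<phi>: "lin_aut k \<phi>"
    and adj: "\<And>u v. u \<in> carrier_vec k \<Longrightarrow> v \<in> carrier_vec k \<Longrightarrow> u \<bullet> \<psi> v = \<phi> u \<bullet> v"
    using lin_aut_adjoint[OF \<psi>] by blast
  have "codeword (map \<psi> G) u = codeword G (\<phi> u)" if "u \<in> carrier_vec k" for u
    using that nth_carrier[OF G] adj by (intro eq_vecI) (auto simp: codeword_def)
  then have "generated_code k (map \<psi> G) = codeword G ` (\<phi> ` carrier_vec k)"
    by (auto simp: generated_code_def image_image)
  then show ?thesis using lin_aut_bij[OF \<phi>] by (simp add: generated_code_def bij_betw_def)
qed

text \<open>
  Two multisets of columns are related if some linear automorphism maps the points of one to the points of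
  the other, counted with multiplicity.
\<close>
definition proj_equiv :: "nat \<Rightarrow> 'a :: field vec multiset \<Rightarrow> 'a vec multiset \<Rightarrow> bool" where
  "proj_equiv k M N \<longleftrightarrow>
    (\<exists>\<psi>. lin_aut k \<psi> \<and> image_mset (\<lambda>v. rep (\<psi> v)) M = image_mset rep N)"

text \<open>
  Equivalence of codes is projective equivalence of the multisets of points: the monomial matrix accounts
  for the choice of the order and the scaling of the columns, the linear automorphism for the choice of a
  basis of the code.
\<close>
lemma code_equiv_generated_code_iff:
  fixes G H :: "'a :: {field, finite} vec list"
  assumes G: "length G = n" "set G \<subseteq> carrier_vec k" "inj_on (codeword G) (carrier_vec k)"
    and H: "length H = n" "set H \<subseteq> carrier_vec k" "inj_on (codeword H) (carrier_vec k)"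
  shows "(generated_code k G, generated_code k H) \<in> code_equiv n k \<longleftrightarrow> proj_equiv k (mset G) (mset H)"
proof
  assume "(generated_code k G, generated_code k H) \<in> code_equiv n k"
  then obtain P where P: "monomial_mat (length G) P"
      and im: "generated_code k H = (\<lambda>c. P\<^sup>T *\<^sub>v c) ` generated_code k G"
    using G(1) by (auto simp: code_equiv_def)
  obtain F where F: "length F = length G" "set F \<subseteq> carrier_vec k"
    "image_mset rep (mset F) = image_mset rep (mset G)"
    "(\<lambda>c. P\<^sup>T *\<^sub>v c) ` generated_code k G = generated_code k F"
    using monomial_image_generated_code[OF G(2) P] by blast
  obtain \<psi> where \<psi>: "lin_aut k \<psi>" "H = map \<psi> F"
    using generated_code_lin_aut[OF F(2) H(2) _ H(3)] F(1,4) im G(1) H(1) by auto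
  have "image_mset (\<lambda>v. rep (\<psi> v)) (mset G) = image_mset (\<lambda>v. rep (\<psi> v)) (mset F)"
    using image_rep_lin_aut[OF \<psi>(1), of "mset F"] image_rep_lin_aut[OF \<psi>(1), of "mset G"] F(2,3) G(2)
    by simp
  also have "\<dots> = image_mset rep (mset H)"
    using \<psi>(2) by (simp add: image_mset.compositionality o_def)
  finally show "proj_equiv k (mset G) (mset H)" using \<psi>(1) by (auto simp: proj_equiv_def)
next
  assume "proj_equiv k (mset G) (mset H)"
  then obtain \<psi> where \<psi>: "lin_aut k \<psi>" "image_mset (\<lambda>v. rep (\<psi> v)) (mset G) = image_mset rep (mset H)"
    by (auto simp: proj_equiv_def)
  have c: "set (map \<psi> G) \<subseteq> carrier_vec k" using G(2) lin_aut_carrier[OF \<psi>(1)] by auto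
  have "image_mset rep (mset H) = image_mset rep (mset (map \<psi> G))"
    using \<psi>(2) by (simp add: image_mset.compositionality o_def)
  from monomial_mat_of_rep_eq[OF c H(2) this]
  obtain P where "monomial_mat n P" "(\<lambda>c. P\<^sup>T *\<^sub>v c) ` generated_code k G = generated_code k H"
    using generated_code_map_lin_aut[OF \<psi>(1) G(2)] G(1) by auto
  moreover have "linear_code n k (generated_code k G)" "linear_code n k (generated_code k H)"
    using G H unfolding linear_code_iff_generated by blast+
  ultimately show "(generated_code k G, generated_code k H) \<in> code_equiv n k"
    by (auto simp: code_equiv_def)
qed

lemma proj_equiv_refl: "proj_equiv k M M"
  using lin_aut_id by (force simp: proj_equiv_def)

lemma proj_equiv_sym:
  fixes M N :: "'a :: {field, finite} vec multiset"
  assumes M: "set_mset M \<subseteq> carrier_vec k" and N: "set_mset N \<subseteq> carrier_vec k"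
    and eq: "proj_equiv k M N"
  shows "proj_equiv k N M"
proof -
  obtain \<psi> where \<psi>: "lin_aut k \<psi>" "image_mset (\<lambda>v. rep (\<psi> v)) M = image_mset rep N"
    using eq by (auto simp: proj_equiv_def)
  obtain \<phi> where \<phi>: "lin_aut k \<phi>" "\<forall>u\<in>carrier_vec k. \<phi> (\<psi> u) = u"
    using lin_aut_inverse[OF \<psi>(1)] by blast
  have "image_mset (\<lambda>v. rep (\<phi> v)) N = image_mset (\<lambda>v. rep (\<phi> v)) (image_mset rep N)"
    using image_rep_lin_aut[OF \<phi>(1) N] by simp
  also have "\<dots> = image_mset (\<lambda>v. rep (\<phi> (rep (\<psi> v)))) M"
    by (simp flip: \<psi>(2) add: image_mset.compositionality o_def)
  also have "\<dots> = image_mset rep M"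
    using M \<phi> rep_lin_aut[OF \<phi>(1) lin_aut_carrier[OF \<psi>(1)]] by (intro image_mset_cong) auto
  finally show ?thesis using \<phi>(1) by (auto simp: proj_equiv_def)
qed

lemma proj_equiv_trans:
  fixes M N L :: "'a :: {field, finite} vec multiset"
  assumes M: "set_mset M \<subseteq> carrier_vec k" and N: "set_mset N \<subseteq> carrier_vec k"
    and eq: "proj_equiv k M N" "proj_equiv k N L"
  shows "proj_equiv k M L"
proof -
  obtain \<psi> where \<psi>: "lin_aut k \<psi>" "image_mset (\<lambda>v. rep (\<psi> v)) M = image_mset rep N"
    using eq by (auto simp: proj_equiv_def)
  obtain \<phi> where \<phi>: "lin_aut k \<phi>" "image_mset (\<lambda>v. rep (\<phi> v)) N = image_mset rep L"
    using eq by (auto simp: proj_equiv_def)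
  have "image_mset (\<lambda>v. rep (\<phi> (\<psi> v))) M = image_mset (\<lambda>v. rep (\<phi> (rep (\<psi> v)))) M"
    using M rep_lin_aut[OF \<phi>(1) lin_aut_carrier[OF \<psi>(1)]] by (intro image_mset_cong) auto
  also have "\<dots> = image_mset (\<lambda>v. rep (\<phi> v)) (image_mset rep N)"
    by (simp flip: \<psi>(2) add: image_mset.compositionality o_def)
  also have "\<dots> = image_mset rep L"
    using image_rep_lin_aut[OF \<phi>(1) N] \<phi>(2) by simp
  finally show ?thesis using lin_aut_comp[OF \<phi>(1) \<psi>(1)] by (auto simp: proj_equiv_def)
qed

text \<open>
  The laws are inherited from projective equivalence, where they come from the group structure of the linear
  automorphisms; inverses and products of monomial matrices are thus avoided.
\<close>
lemma equiv_code_equiv: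
  "equiv {C. linear_code n k C} (code_equiv n k :: ('a :: {field, finite} vec set \<times> 'a vec set) set)"
proof -
  have gen: "\<exists>G. length G = n \<and> set G \<subseteq> carrier_vec k \<and> inj_on (codeword G) (carrier_vec k) \<and>
      C = generated_code k G" if "linear_code n k C" for C :: "'a vec set"
    using linear_code_generated[OF that] .
  have sub: "code_equiv n k \<subseteq> {C. linear_code n k C} \<times> {C :: 'a vec set. linear_code n k C}"
    by (auto simp: code_equiv_def)
  have refl: "(C, C) \<in> code_equiv n k" if "linear_code n k C" for C :: "'a vec set"
  proof -
    obtain G where G: "length G = n" "set G \<subseteq> carrier_vec k" "inj_on (codeword G) (carrier_vec k)"
        "C = generated_code k G" using gen \<open>linear_code n k C\<close> by blast
    show ?thesis
      unfolding G(4) code_equiv_generated_code_iff[OF G(1-3) G(1-3)] by (rule proj_equiv_refl)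
  qed
  have sym: "(D, C) \<in> code_equiv n k" if CD: "(C, D) \<in> code_equiv n k" for C D :: "'a vec set"
  proof -
    obtain G where G: "length G = n" "set G \<subseteq> carrier_vec k" "inj_on (codeword G) (carrier_vec k)"
        "C = generated_code k G" using gen sub CD by blast
    obtain H where H: "length H = n" "set H \<subseteq> carrier_vec k" "inj_on (codeword H) (carrier_vec k)"
        "D = generated_code k H" using gen sub CD by blast
    show ?thesis
      using CD proj_equiv_sym[of "mset G" k "mset H"] G(2) H(2)
      unfolding G(4) H(4) code_equiv_generated_code_iff[OF G(1-3) H(1-3)]
        code_equiv_generated_code_iff[OF H(1-3) G(1-3)] by simp
  qed
  have trans: "(C, E) \<in> code_equiv n k" if CD: "(C, D) \<in> code_equiv n k" and DE: "(D, E) \<in> code_equiv n k"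
    for C D E :: "'a vec set"
  proof -
    obtain G where G: "length G = n" "set G \<subseteq> carrier_vec k" "inj_on (codeword G) (carrier_vec k)"
        "C = generated_code k G" using gen sub CD by blast
    obtain H where H: "length H = n" "set H \<subseteq> carrier_vec k" "inj_on (codeword H) (carrier_vec k)"
        "D = generated_code k H" using gen sub CD by blast
    obtain K where K: "length K = n" "set K \<subseteq> carrier_vec k" "inj_on (codeword K) (carrier_vec k)"
        "E = generated_code k K" using gen sub DE by blast
    show ?thesis
      using CD DE proj_equiv_trans[of "mset G" k "mset H" "mset K"] G(2) H(2)
      unfolding G(4) H(4) K(4) code_equiv_generated_code_iff[OF G(1-3) H(1-3)]
        code_equiv_generated_code_iff[OF H(1-3) K(1-3)] code_equiv_generated_code_iff[OF G(1-3) K(1-3)]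
      by simp
  qed
  show ?thesis
    using sub refl sym trans
    by (intro equivI refl_onI symI transI) blast+
qed

section \<open>Avoiding zero columns\<close>

lemma gram_sym: "gram M u w = gram M w u"
  by (simp add: gram_def mult.commute)

lemma gram_add_left:
  "set_mset M \<subseteq> carrier_vec k \<Longrightarrow> u \<in> carrier_vec k \<Longrightarrow> u' \<in> carrier_vec k \<Longrightarrow>
    gram M (u + u') w = gram M u w + gram M u' w"
  by (induction M) (auto simp: add_scalar_prod_distrib[of _ k] algebra_simps)

lemma gram_smult_left:
  "set_mset M \<subseteq> carrier_vec k \<Longrightarrow> u \<in> carrier_vec k \<Longrightarrow> gram M (a \<cdot>\<^sub>v u) w = a * gram M u w"
  by (induction M) (auto simp: smult_scalar_prod_distrib[of _ k] algebra_simps)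

lemma gram_eq_scalar_prod:
  fixes M :: "'a :: field vec multiset"
  assumes M: "set_mset M \<subseteq> carrier_vec k"
  shows "\<exists>p\<in>carrier_vec k. \<forall>w\<in>carrier_vec k. gram M s w = p \<bullet> w"
proof
  show "\<forall>w\<in>carrier_vec k. gram M s w = vec k (\<lambda>i. gram M s (unit_vec k i)) \<bullet> w"
  proof
    fix w :: "'a vec" assume w: "w \<in> carrier_vec k"
    show "gram M s w = vec k (\<lambda>i. gram M s (unit_vec k i)) \<bullet> w"
      by (rule linear_functional_scalar_prod[where L = "gram M s", OF _ _ w])
        (use gram_add_left[OF M] gram_smult_left[OF M] gram_sym in metis)+
  qed
qed simp

lemma wt_replicate [simp]: "wt (replicate_mset z p) u = z * of_bool (u \<bullet> p \<noteq> 0)"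
  by (induction z) auto

lemma gram_replicate [simp]: "gram (replicate_mset z p) u w = of_nat z * ((u \<bullet> p) * (w \<bullet> p))"
  by (induction z) (auto simp: algebra_simps)

lemma split_zero_columns: "M = filter_mset (\<lambda>v. v \<noteq> z) M + replicate_mset (count M z) z"
  using multiset_partition[of M "\<lambda>v. v \<noteq> z"] by (simp add: filter_eq_replicate_mset)

lemma wt_nonzero_columns:
  assumes "u \<in> carrier_vec k"
  shows "wt M u = wt (filter_mset (\<lambda>v. v \<noteq> 0\<^sub>v k) M) u"
  using assms by (subst split_zero_columns[of M "0\<^sub>v k"]) simp

lemma gram_nonzero_columns:
  assumes "u \<in> carrier_vec k"
  shows "gram M u w = gram (filter_mset (\<lambda>v. v \<noteq> 0\<^sub>v k) M) u w"
  using assms by (subst split_zero_columns[of M "0\<^sub>v k"]) simp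

text \<open>
  The hyperplane orthogonal to \<open>b\<close> has \<open>q ^ (k - 1) \<ge> 4\<close> elements, so two of them can be chosen one after the
  other, the second outside of \<open>0\<close>, \<open>x\<close> and \<open>- x\<close>.
\<close>
lemma exists_two_orthogonal:
  fixes b :: "'a :: {field, finite} vec"
  assumes k: "k \<ge> 3" and b: "b \<in> carrier_vec k" "b \<noteq> 0\<^sub>v k"
  shows "\<exists>x\<in>carrier_vec k. \<exists>y\<in>carrier_vec k. x \<bullet> b = 0 \<and> y \<bullet> b = 0 \<and>
    x \<noteq> 0\<^sub>v k \<and> y \<noteq> 0\<^sub>v k \<and> x + y \<noteq> 0\<^sub>v k \<and> x - y \<noteq> 0\<^sub>v k"
proof -
  let ?S = "{x \<in> carrier_vec k. x \<bullet> b = 0}"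
  let ?q = "CARD('a)"
  have q: "?q \<ge> 2" by (rule card_field_ge_2)
  have fin: "finite ?S" by (simp add: finite_carrier_vec)
  have kk: "?q ^ k = ?q * ?q ^ (k - 1)" using k by (cases k) auto
  have "card (carrier_vec k :: 'a vec set) = card ?S + card {x \<in> carrier_vec k. x \<bullet> b \<noteq> 0}"
    by (subst card_Un_disjoint[symmetric]) (auto simp: finite_carrier_vec intro: arg_cong[where f = card])
  then have "?q * ?q ^ (k - 1) = card ?S + (?q - 1) * ?q ^ (k - 1)"
    using card_scalar_prod_nonzero[OF b] k by (simp add: card_carrier_vec kk)
  moreover have "?q * ?q ^ (k - 1) = ?q ^ (k - 1) + (?q - 1) * ?q ^ (k - 1)"
    using q by (cases ?q) auto
  ultimately have cS: "card ?S = ?q ^ (k - 1)" by linarith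
  have "2 ^ 2 \<le> ?q ^ 2" using q by (rule power_mono) simp
  also have "?q ^ 2 \<le> ?q ^ (k - 1)" using q k by (intro power_increasing) auto
  finally have four: "4 \<le> card ?S" using cS by simp
  have ex: "\<exists>x\<in>?S. x \<notin> T" if "finite T" "card T \<le> 3" for T
    using card_mono[OF that(1), of ?S] that(2) four by force
  obtain x where x: "x \<in> ?S" "x \<noteq> 0\<^sub>v k" using ex[of "{0\<^sub>v k}"] by auto
  have "card {0\<^sub>v k, x, - x} \<le> 3" by (simp add: card_insert_if)
  then obtain y where y: "y \<in> ?S" "y \<noteq> 0\<^sub>v k" "y \<noteq> x" "y \<noteq> - x"
    using ex[of "{0\<^sub>v k, x, - x}"] by auto
  have xk: "x \<in> carrier_vec k" and yk: "y \<in> carrier_vec k" using x y by auto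
  have "x + y \<noteq> 0\<^sub>v k"
  proof
    assume e: "x + y = 0\<^sub>v k"
    have "y = - x"
    proof (rule eq_vecI)
      fix i assume "i < dim_vec (- x)"
      then have "i < k" using xk by simp
      then show "y $ i = (- x) $ i"
        using arg_cong[OF e, of "\<lambda>v. v $ i"] xk yk by (simp add: eq_neg_iff_add_eq_0 add.commute)
    qed (use x y in auto)
    then show False using y by blast
  qed
  moreover have "x - y \<noteq> 0\<^sub>v k"
  proof
    assume e: "x - y = 0\<^sub>v k"
    have "y = x"
    proof (rule eq_vecI)
      fix i assume "i < dim_vec x"
      then have "i < k" using xk by simp
      then show "y $ i = x $ i"
        using arg_cong[OF e, of "\<lambda>v. v $ i"] xk yk by simp
    qed (use x y in auto)
    then show False using y by blast
  qed
  ultimately show ?thesis using x y by blast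
qed

text \<open>
  Write \<open>B\<close> for the Gram form and take two vectors \<open>x\<close>, \<open>y\<close> orthogonal to \<open>h\<close> as in the previous lemma. If
  \<open>1 + z * B(s, s) = 0\<close> for \<open>s = x\<close>, \<open>y\<close>, \<open>x + y\<close> and \<open>x - y\<close>, then expanding \<open>B(x + y, x + y)\<close> and
  \<open>B(x - y, x - y)\<close> gives \<open>2 * z * B(x, y) = 1\<close> and \<open>2 * z * B(x, y) = - 1\<close>. Hence \<open>2 = 0\<close>, which contradicts
  the first of the two equations.
\<close>
lemma exists_nondegenerate_update:
  fixes M :: "'a :: {field, finite} vec multiset"
  assumes q: "CARD('a) \<in> {2, 3}" and k: "k \<ge> 3"
    and M: "set_mset M \<subseteq> carrier_vec k" and nd: "nondegenerate k M"
    and h: "h \<in> carrier_vec k" "h \<noteq> 0\<^sub>v k"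
  shows "\<exists>s\<in>carrier_vec k. s \<noteq> 0\<^sub>v k \<and> gram M s h = 0 \<and> 1 + z * gram M s s \<noteq> 0"
proof -
  obtain b where b: "b \<in> carrier_vec k" "\<And>w. w \<in> carrier_vec k \<Longrightarrow> gram M h w = b \<bullet> w"
    using gram_eq_scalar_prod[OF M] by blast
  have "b \<noteq> 0\<^sub>v k" using nd h b unfolding nondegenerate_def by (metis scalar_prod_left_zero)
  then obtain x y where x: "x \<in> carrier_vec k" "x \<bullet> b = 0" "x \<noteq> 0\<^sub>v k"
      and y: "y \<in> carrier_vec k" "y \<bullet> b = 0" "y \<noteq> 0\<^sub>v k"
      and xy: "x + y \<noteq> 0\<^sub>v k" "x - y \<noteq> 0\<^sub>v k"
    using exists_two_orthogonal[OF k b(1)] by blast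
  have orth: "gram M s h = 0" if "s \<in> carrier_vec k" "s \<bullet> b = 0" for s
    using that b comm_scalar_prod[OF b(1) that(1)] by (simp add: gram_sym[of M s])
  have minus: "x - y = x + (- 1) \<cdot>\<^sub>v y" using x y by (intro eq_vecI) auto
  have "gram M x h = 0" "gram M y h = 0" using orth x y by auto
  then have orth': "gram M (x + y) h = 0" "gram M (x - y) h = 0"
    using x y by (simp_all add: minus gram_add_left[OF M] gram_smult_left[OF M])
  have bil: "gram M u (v + w) = gram M u v + gram M u w" "gram M u (a \<cdot>\<^sub>v v) = a * gram M u v"
    if "v \<in> carrier_vec k" "w \<in> carrier_vec k" for u v w a
    using that by (simp_all add: gram_sym[of M u] gram_add_left[OF M] gram_smult_left[OF M])
  have plus: "gram M (x + y) (x + y) = gram M x x + gram M y y + 2 * gram M x y"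
    using x y by (simp add: gram_add_left[OF M] bil gram_sym[of M y x] algebra_simps)
  have diff: "gram M (x - y) (x - y) = gram M x x + gram M y y - 2 * gram M x y"
    using x y by (simp add: minus gram_add_left[OF M] gram_smult_left[OF M] bil gram_sym[of M y x] algebra_simps)
  have "1 + z * gram M x x \<noteq> 0 \<or> 1 + z * gram M y y \<noteq> 0 \<or>
      1 + z * gram M (x + y) (x + y) \<noteq> 0 \<or> 1 + z * gram M (x - y) (x - y) \<noteq> 0"
  proof (rule ccontr)
    assume "\<not> ?thesis"
    then have e: "z * gram M x x = - 1" "z * gram M y y = - 1"
        "1 + z * gram M (x + y) (x + y) = 0" "1 + z * gram M (x - y) (x - y) = 0"
      by (auto simp: eq_neg_iff_add_eq_0 add.commute)
    have p: "2 * (z * gram M x y) = 1"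
      using e(3) unfolding plus distrib_left e(1,2) by (simp add: algebra_simps)
    have m: "2 * (z * gram M x y) = - 1"
      using e(4) unfolding diff distrib_left right_diff_distrib e(1,2) by (simp add: algebra_simps)
    have two: "(2 :: 'a) = 0" using p m by (metis add.right_inverse one_add_one)
    then show False using p by simp
  qed
  then show ?thesis using x y xy orth orth' by (metis add_carrier_vec minus_carrier_vec)
qed

text \<open>
  The \<open>z\<close> zero columns are replaced by a column \<open>p\<close> that represents the functional \<open>B(s, -)\<close>, where \<open>B\<close> is
  the Gram form and \<open>s\<close> comes from the previous lemma for a message \<open>h\<close> of minimum weight. Weights can only
  grow, and the weight of \<open>h\<close> does not, since \<open>h \<bullet> p = B(s, h) = 0\<close>. The new form is
  \<open>B(u, w) + z * (u \<bullet> p) * (w \<bullet> p)\<close>, and the condition \<open>1 + z * B(s, s) \<noteq> 0\<close> is the nonvanishing of the factor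
  by which this rank one update changes the determinant.
\<close>
lemma fill_zero_columns:
  fixes C :: "'a :: {field, finite} vec set"
  assumes q: "CARD('a) \<in> {2, 3}" and k: "k \<ge> 3" and C: "C \<in> LCD_codes n k d"
  shows "\<exists>D :: 'a vec set. D \<in> LCD_codes_dual2 n k d"
proof -
  obtain G :: "'a vec list" where G: "length G = n" "set G \<subseteq> carrier_vec k"
      "nondegenerate k (mset G)" "has_min_wt k d (mset G)"
    using C unfolding LCD_codes_iff by blast
  let ?M = "mset G"
  have M: "set_mset ?M \<subseteq> carrier_vec k" using G(2) by simp
  obtain h where h: "h \<in> carrier_vec k" "h \<noteq> 0\<^sub>v k" "wt ?M h = d"
    using G(4) by (auto simp: has_min_wt_def)
  define z where "z = count ?M (0\<^sub>v k)"
  obtain s where s: "s \<in> carrier_vec k" "s \<noteq> 0\<^sub>v k" "gram ?M s h = 0" "1 + of_nat z * gram ?M s s \<noteq> 0"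
    using exists_nondegenerate_update[OF q k M G(3) h(1,2)] by blast
  obtain p where p: "p \<in> carrier_vec k" "\<And>w. w \<in> carrier_vec k \<Longrightarrow> gram ?M s w = p \<bullet> w"
    using gram_eq_scalar_prod[OF M] by blast
  have p0: "p \<noteq> 0\<^sub>v k" using G(3) s p unfolding nondegenerate_def by (metis scalar_prod_left_zero)
  have up: "u \<bullet> p = gram ?M s u" if "u \<in> carrier_vec k" for u
    using p that comm_scalar_prod[OF p(1) that] by simp
  define N where "N = filter_mset (\<lambda>v. v \<noteq> 0\<^sub>v k) ?M + replicate_mset z p"
  have wtN: "wt N u = wt ?M u + z * of_bool (u \<bullet> p \<noteq> 0)" if "u \<in> carrier_vec k" for u
    using wt_nonzero_columns[OF that, of ?M] by (simp add: N_def)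
  have gramN: "gram N u w = gram ?M u w + of_nat z * ((u \<bullet> p) * (w \<bullet> p))"
    if "u \<in> carrier_vec k" for u w
    using gram_nonzero_columns[OF that, of ?M] by (simp add: N_def)
  have "nondegenerate k N"
    unfolding nondegenerate_def
  proof (intro ballI impI)
    fix u :: "'a vec" assume u: "u \<in> carrier_vec k" and rad: "\<forall>w\<in>carrier_vec k. gram N u w = 0"
    (* u is in the radical of the new form exactly if t is in the radical of the old one. *)
    define c where "c = of_nat z * (u \<bullet> p)"
    define t where "t = u + c \<cdot>\<^sub>v s"
    have t: "t \<in> carrier_vec k" using u s by (simp add: t_def)
    have "gram ?M t w = 0" if w: "w \<in> carrier_vec k" for w
    proof -
      have "gram ?M t w = gram ?M u w + c * gram ?M s w"
        using u s by (simp add: t_def gram_add_left[OF M] gram_smult_left[OF M])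
      also have "\<dots> = gram N u w" using gramN[OF u, of w] up[OF w] by (simp add: c_def)
      finally show ?thesis using rad w by simp
    qed
    then have t0: "t = 0\<^sub>v k" using G(3) t by (auto simp: nondegenerate_def)
    have "0 = t \<bullet> p" using t0 p by simp
    also have "\<dots> = u \<bullet> p + c * (s \<bullet> p)"
      using u s p by (simp add: t_def add_scalar_prod_distrib[of _ k])
    also have "\<dots> = (u \<bullet> p) * (1 + of_nat z * gram ?M s s)"
      using up[OF s(1)] by (simp add: c_def algebra_simps)
    finally have "u \<bullet> p = 0" using s(4) by simp
    then have "c = 0" by (simp add: c_def)
    then have "t = u" using u s by (intro eq_vecI) (auto simp: t_def)
    then show "u = 0\<^sub>v k" using t0 by simp
  qed
  moreover have "has_min_wt k d N"
    using G(4) h up[OF h(1)] s(3) wtN unfolding has_min_wt_def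
    by (auto intro!: trans_le_add1 bexI[of _ h])
  moreover have "set_mset N \<subseteq> carrier_vec k - {0\<^sub>v k}"
    using M p p0 by (auto simp: N_def)
  moreover have "size N = n"
    using arg_cong[OF split_zero_columns[of ?M "0\<^sub>v k"], of size] G(1) by (simp add: N_def z_def)
  moreover obtain H where "mset H = N" using ex_mset by blast
  ultimately have "length H = n \<and> set H \<subseteq> carrier_vec k - {0\<^sub>v k} \<and>
    nondegenerate k (mset H) \<and> has_min_wt k d (mset H)"
    by (metis set_mset_mset size_mset)
  then show ?thesis unfolding LCD_codes_dual2_iff by blast
qed

lemma of_nat_eq_0_ternary:
  assumes "CARD('a :: {field, finite}) = 3"
  shows "(of_nat x :: 'a) = 0 \<longleftrightarrow> 3 dvd x"
proof -
  have three: "(3 :: 'a) = 0" using of_nat_card_field[where 'a = 'a] assms by simp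
  have two: "(2 :: 'a) \<noteq> 0"
  proof
    assume "(2 :: 'a) = 0"
    then have "(3 :: 'a) - 2 = 0" using three by simp
    then show False by simp
  qed
  have "of_nat x = (of_nat (3 * (x div 3) + x mod 3) :: 'a)" by simp
  also have "\<dots> = of_nat (x mod 3)" using three by (simp only: of_nat_add of_nat_mult) simp
  finally have *: "of_nat x = (of_nat (x mod 3) :: 'a)" .
  have "x mod 3 = 0 \<or> x mod 3 = 1 \<or> x mod 3 = 2" by arith
  then show ?thesis unfolding * dvd_eq_mod_eq_0 using two by auto
qed

text \<open>
  The four points of the projective line over the field with three elements get the multiplicities
  \<open>r\<close>, \<open>r\<close>, \<open>x\<close>, \<open>y\<close> with \<open>x + y = r\<close>. A nonzero message is orthogonal to only one of the four points, so the
  minimum weight is \<open>3 * r - r\<close>. The determinant of the Gram form is \<open>x * y\<close> modulo 3, so \<open>x\<close> and \<open>y\<close> must be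
  prime to 3; this is possible for all \<open>r \<ge> 2\<close>.
\<close>
lemma ternary_plane_code:
  assumes q: "CARD('a :: {field, finite}) = 3" and r: "r \<ge> 2"
  shows "\<exists>C :: 'a vec set. C \<in> LCD_codes_dual2 (3 * r) 2 (2 * r)"
proof -
  obtain x y where xy: "x + y = r" "\<not> 3 dvd x" "\<not> 3 dvd y"
  proof (cases "r mod 3 = 1")
    case True
    then show ?thesis using r by (intro that[of 2 "r - 2"]) presburger+
  next
    case False
    then show ?thesis using r by (intro that[of 1 "r - 1"]) presburger+
  qed
  let ?e = "unit_vec 2 0 :: 'a vec" and ?f = "unit_vec 2 1 :: 'a vec"
  define M where "M = replicate_mset r ?e + replicate_mset r ?f +
    replicate_mset x (?e + ?f) + replicate_mset y (?e - ?f)"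
  have dots: "u \<bullet> ?e = u $ 0" "u \<bullet> ?f = u $ 1" "u \<bullet> (?e + ?f) = u $ 0 + u $ 1"
      "u \<bullet> (?e - ?f) = u $ 0 - u $ 1" if "u \<in> carrier_vec 2" for u
    using that by (auto simp: scalar_prod_add_distrib[of _ 2] scalar_prod_minus_distrib[of _ 2])
  have wtM: "wt M u = r * of_bool (u $ 0 \<noteq> 0) + r * of_bool (u $ 1 \<noteq> 0) +
      x * of_bool (u $ 0 + u $ 1 \<noteq> 0) + y * of_bool (u $ 0 - u $ 1 \<noteq> 0)" if "u \<in> carrier_vec 2" for u
    unfolding M_def wt_union wt_replicate dots[OF that] by simp
  have eq0: "u = 0\<^sub>v 2 \<longleftrightarrow> u $ 0 = 0 \<and> u $ 1 = 0" if "u \<in> carrier_vec 2" for u :: "'a vec"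
    using that by (auto intro!: eq_vecI simp: less_2_cases_iff)
  have "has_min_wt 2 (2 * r) M"
    unfolding has_min_wt_def
  proof (intro conjI ballI)
    fix u :: "'a vec" assume "u \<in> carrier_vec 2 - {0\<^sub>v 2}"
    then have u: "u \<in> carrier_vec 2" "u $ 0 \<noteq> 0 \<or> u $ 1 \<noteq> 0" using eq0 by auto
    show "2 * r \<le> wt M u" unfolding wtM[OF u(1)] using u(2) xy(1) by auto
  next
    show "\<exists>u\<in>carrier_vec 2 - {0\<^sub>v 2}. wt M u = 2 * r"
      by (rule bexI[of _ ?e]) (use xy(1) in \<open>auto simp: wtM\<close>)
  qed
  moreover have "nondegenerate 2 M"
    unfolding nondegenerate_def
  proof (intro ballI impI)
    fix u :: "'a vec" assume u: "u \<in> carrier_vec 2" and rad: "\<forall>w\<in>carrier_vec 2. gram M u w = 0"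
    define X Y where "X = (of_nat x :: 'a)" and "Y = (of_nat y :: 'a)"
    have R: "(of_nat r :: 'a) = X + Y" using xy(1) by (auto simp: X_def Y_def)
    have nz: "X \<noteq> 0" "Y \<noteq> 0" using xy of_nat_eq_0_ternary[OF q] by (auto simp: X_def Y_def)
    have three: "(3 :: 'a) = 0" using of_nat_card_field[where 'a = 'a] q by simp
    have gramM: "gram M u w = (X + Y) * (u $ 0 * w $ 0) + (X + Y) * (u $ 1 * w $ 1) +
        X * ((u $ 0 + u $ 1) * (w $ 0 + w $ 1)) + Y * ((u $ 0 - u $ 1) * (w $ 0 - w $ 1))"
      if "w \<in> carrier_vec 2" for w
      unfolding M_def gram_union gram_replicate dots[OF that] dots[OF u] R X_def[symmetric] Y_def[symmetric] by simp
    have a: "(X + Y) * u $ 0 + X * (u $ 0 + u $ 1) + Y * (u $ 0 - u $ 1) = 0"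
      using rad[rule_format, of ?e] gramM[of ?e] by simp
    have b: "(X + Y) * u $ 1 + X * (u $ 0 + u $ 1) - Y * (u $ 0 - u $ 1) = 0"
      using rad[rule_format, of ?f] gramM[of ?f] by (simp add: algebra_simps)
    (* Modulo 3 the two equations add up to Y * (u $ 0 + u $ 1) = 0 and subtract to
       X * (u $ 0 - u $ 1) = 0. *)
    define A where "A = (X + Y) * u $ 0 + X * (u $ 0 + u $ 1) + Y * (u $ 0 - u $ 1)"
    define B where "B = (X + Y) * u $ 1 + X * (u $ 0 + u $ 1) - Y * (u $ 0 - u $ 1)"
    have AB: "A = 0" "B = 0" using a b by (simp_all add: A_def B_def)
    have "Y * (u $ 0 + u $ 1) = A + B - 3 * (X * (u $ 0 + u $ 1))"
      by (simp add: A_def B_def algebra_simps)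
    then have "Y * (u $ 0 + u $ 1) = 0" unfolding AB three by simp
    moreover have "X * (u $ 0 - u $ 1) = A - B - 3 * (Y * (u $ 0 - u $ 1))"
      by (simp add: A_def B_def algebra_simps)
    then have "X * (u $ 0 - u $ 1) = 0" unfolding AB three by simp
    ultimately have e: "u $ 0 + u $ 1 = 0" "u $ 0 - u $ 1 = 0" using nz by auto
    have "u $ 0 = 3 * u $ 0 - ((u $ 0 + u $ 1) + (u $ 0 - u $ 1))" by (simp add: algebra_simps)
    then have "u $ 0 = 0" unfolding e three by simp
    then show "u = 0\<^sub>v 2" using e eq0[OF u] by simp
  qed
  moreover have "size M = 3 * r" using xy(1) by (simp add: M_def)
  moreover have "set_mset M \<subseteq> carrier_vec 2 - {0\<^sub>v 2}"
    by (auto simp: M_def eq0 split: if_splits)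
  moreover obtain H where "mset H = M" using ex_mset by blast
  ultimately have "length H = 3 * r \<and> set H \<subseteq> carrier_vec 2 - {0\<^sub>v 2} \<and>
    nondegenerate 2 (mset H) \<and> has_min_wt 2 (2 * r) (mset H)"
    by (metis set_mset_mset size_mset)
  then show ?thesis unfolding LCD_codes_dual2_iff by blast
qed

text \<open>
  The minimum weight is at most the average weight of the nonzero messages.
\<close>
lemma average_weight_bound:
  fixes M :: "'a :: {field, finite} vec multiset"
  assumes k: "k \<ge> 1" and M: "set_mset M \<subseteq> carrier_vec k - {0\<^sub>v k}"
    and d: "\<And>u. u \<in> carrier_vec k \<Longrightarrow> u \<noteq> 0\<^sub>v k \<Longrightarrow> d \<le> wt M u"
  shows "(CARD('a) ^ k - 1) * d \<le> (CARD('a) - 1) * CARD('a) ^ (k - 1) * size M"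
proof -
  let ?V = "carrier_vec k :: 'a vec set"
  have "(CARD('a) ^ k - 1) * d = (\<Sum>u\<in>?V - {0\<^sub>v k}. d)"
    by (simp add: card_Diff_singleton card_carrier_vec finite_carrier_vec)
  also have "\<dots> \<le> (\<Sum>u\<in>?V - {0\<^sub>v k}. wt M u)" by (rule sum_mono) (auto intro: d)
  also have "\<dots> \<le> (\<Sum>u\<in>?V. wt M u)" by (rule sum_mono2) (auto simp: finite_carrier_vec)
  also have "\<dots> = (\<Sum>v\<in>#M. card {u \<in> ?V. u \<bullet> v \<noteq> 0})" by (rule sum_wt[OF finite_carrier_vec])
  also have "\<dots> = (\<Sum>v\<in>#M. (CARD('a) - 1) * CARD('a) ^ (k - 1))"
    using M k by (intro arg_cong[where f = sum_mset] image_mset_cong card_scalar_prod_nonzero) auto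
  also have "\<dots> = (CARD('a) - 1) * CARD('a) ^ (k - 1) * size M" by simp
  finally show ?thesis .
qed

section \<open>Adding and removing copies of the simplex code\<close>

lemma image_repeat_mset: "image_mset f (repeat_mset a M) = repeat_mset a (image_mset f M)"
  by (induction a) auto

text \<open>
  The code \<open>D\<close> of length \<open>m\<close> arises from the code \<open>C\<close> of length \<open>n\<close> by adding every point \<open>a\<close> times as a column,
  up to the order and the scaling of the columns.
\<close>
definition simplex_extension ::
  "nat \<Rightarrow> nat \<Rightarrow> nat \<Rightarrow> nat \<Rightarrow> 'a :: {field, finite} vec set \<Rightarrow> 'a vec set \<Rightarrow> bool" where
  "simplex_extension n m k a C D \<longleftrightarrow> (\<exists>G H.
    length G = n \<and> set G \<subseteq> carrier_vec k \<and> nondegenerate k (mset G) \<and> C = generated_code k G \<and>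
    length H = m \<and> set H \<subseteq> carrier_vec k \<and> nondegenerate k (mset H) \<and> D = generated_code k H \<and>
    image_mset rep (mset H) = image_mset rep (mset G) + repeat_mset a (simplex k))"

lemma wt_add_simplex:
  fixes M :: "'a :: {field, finite} vec multiset"
  assumes k: "k \<ge> 1" and M: "set_mset M \<subseteq> carrier_vec k" and N: "set_mset N \<subseteq> carrier_vec k"
    and eq: "image_mset rep N = image_mset rep M + repeat_mset a (simplex k)"
    and u: "u \<in> carrier_vec k" "u \<noteq> 0\<^sub>v k"
  shows "wt N u = wt M u + a * CARD('a) ^ (k - 1)"
  using wt_image_rep[OF N u(1)] wt_image_rep[OF M u(1)] wt_simplex[OF u k] eq by simp

lemma has_min_wt_add_simplex:
  fixes M :: "'a :: {field, finite} vec multiset"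
  assumes k: "k \<ge> 1" and M: "set_mset M \<subseteq> carrier_vec k" and N: "set_mset N \<subseteq> carrier_vec k"
    and eq: "image_mset rep N = image_mset rep M + repeat_mset a (simplex k)"
  shows "has_min_wt k (d + a * CARD('a) ^ (k - 1)) N \<longleftrightarrow> has_min_wt k d M"
  using wt_add_simplex[OF assms] unfolding has_min_wt_def by auto

lemma nondegenerate_add_simplex:
  fixes M :: "'a :: {field, finite} vec multiset"
  assumes qk: "CARD('a) = 2 \<and> k \<ge> 3 \<or> CARD('a) = 3 \<and> k \<ge> 2"
    and M: "set_mset M \<subseteq> carrier_vec k" and N: "set_mset N \<subseteq> carrier_vec k"
    and eq: "image_mset rep N = image_mset rep M + repeat_mset a (simplex k)"
  shows "nondegenerate k N \<longleftrightarrow> nondegenerate k M"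
proof -
  have q: "CARD('a) \<in> {2, 3}" using qk by auto
  have "gram N u w = gram M u w" if u: "u \<in> carrier_vec k" and w: "w \<in> carrier_vec k" for u w
    using gram_image_rep[OF q u w N] gram_image_rep[OF q u w M] gram_simplex[OF qk u w] eq by simp
  then show ?thesis by (simp add: nondegenerate_def)
qed

text \<open>
  A linear automorphism permutes the points, so the added copies of all points are mapped to themselves and
  cancel.
\<close>
lemma proj_equiv_add_simplex:
  fixes M :: "'a :: {field, finite} vec multiset"
  assumes M: "set_mset M \<subseteq> carrier_vec k" and N: "set_mset N \<subseteq> carrier_vec k"
    and eq: "image_mset rep N = image_mset rep M + repeat_mset a (simplex k)"
    and eq': "image_mset rep N' = image_mset rep M' + repeat_mset a (simplex k)"
  shows "proj_equiv k N N' \<longleftrightarrow> proj_equiv k M M'"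
proof -
  have "image_mset (\<lambda>v. rep (\<psi> v)) N = image_mset rep N' \<longleftrightarrow>
      image_mset (\<lambda>v. rep (\<psi> v)) M = image_mset rep M'" if \<psi>: "lin_aut k \<psi>" for \<psi>
  proof -
    have "image_mset (\<lambda>v. rep (\<psi> v)) N = image_mset (\<lambda>v. rep (\<psi> v)) (image_mset rep N)"
      by (rule image_rep_lin_aut[OF \<psi> N, symmetric])
    also have "\<dots> = image_mset (\<lambda>v. rep (\<psi> v)) M + repeat_mset a (simplex k)"
      unfolding eq image_mset_union image_rep_lin_aut[OF \<psi> M] image_repeat_mset
        simplex_lin_aut[OF \<psi>] ..
    finally show ?thesis unfolding eq' by simp
  qed
  then show ?thesis unfolding proj_equiv_def by blast
qed

lemma simplex_extension_code_equiv:
  assumes CD: "simplex_extension n m k a C D" and CD': "simplex_extension n m k a C' D'"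
  shows "(C, C') \<in> code_equiv n k \<longleftrightarrow> (D, D') \<in> code_equiv m k"
proof -
  obtain G H where G: "length G = n" "set G \<subseteq> carrier_vec k" "nondegenerate k (mset G)" "C = generated_code k G"
    and H: "length H = m" "set H \<subseteq> carrier_vec k" "nondegenerate k (mset H)" "D = generated_code k H"
    and eq: "image_mset rep (mset H) = image_mset rep (mset G) + repeat_mset a (simplex k)"
    using CD unfolding simplex_extension_def by blast
  obtain G' H' where G': "length G' = n" "set G' \<subseteq> carrier_vec k" "nondegenerate k (mset G')" "C' = generated_code k G'"
    and H': "length H' = m" "set H' \<subseteq> carrier_vec k" "nondegenerate k (mset H')" "D' = generated_code k H'"
    and eq': "image_mset rep (mset H') = image_mset rep (mset G') + repeat_mset a (simplex k)"
    using CD' unfolding simplex_extension_def by blast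
  note inj = nondegenerate_inj_codeword[OF G(2,3)] nondegenerate_inj_codeword[OF H(2,3)]
    nondegenerate_inj_codeword[OF G'(2,3)] nondegenerate_inj_codeword[OF H'(2,3)]
  show ?thesis
    unfolding G(4) H(4) G'(4) H'(4)
      code_equiv_generated_code_iff[OF G(1,2) inj(1) G'(1,2) inj(3)]
      code_equiv_generated_code_iff[OF H(1,2) inj(2) H'(1,2) inj(4)]
    using proj_equiv_add_simplex[OF _ _ eq eq'] G(2) H(2) by simp
qed

lemma add_simplices:
  fixes C :: "'a :: {field, finite} vec set"
  assumes qk: "CARD('a) = 2 \<and> k \<ge> 3 \<or> CARD('a) = 3 \<and> k \<ge> 2"
    and C: "C \<in> LCD_codes_dual2 n k d"
    and m: "m = n + a * card (points k :: 'a vec set)" and e: "e = d + a * CARD('a) ^ (k - 1)"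
  shows "\<exists>D\<in>LCD_codes_dual2 m k e. simplex_extension n m k a C D"
proof -
  obtain G where G: "length G = n" "set G \<subseteq> carrier_vec k - {0\<^sub>v k}" "nondegenerate k (mset G)"
      "has_min_wt k d (mset G)" "C = generated_code k G"
    using C unfolding LCD_codes_dual2_iff by blast
  obtain H where mH: "mset H = mset G + repeat_mset a (simplex k)" using ex_mset by blast
  have sS: "set_mset (repeat_mset a (simplex k :: 'a vec multiset)) \<subseteq> points k"
    by (induction a) auto
  have H: "set H \<subseteq> carrier_vec k - {0\<^sub>v k}"
    using arg_cong[OF mH, of set_mset] sS G(2) points_carrier[of k] zero_notin_points[of k]
    unfolding set_mset_union set_mset_mset by blast
  have "image_mset rep (simplex k :: 'a vec multiset) = simplex k"
    by (rule trans[OF image_mset_cong[where g = "\<lambda>v. v"]]) (auto simp: rep_points)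
  then have eq: "image_mset rep (mset H) = image_mset rep (mset G) + repeat_mset a (simplex k)"
    by (simp add: mH image_repeat_mset)
  have c: "set_mset (mset G) \<subseteq> carrier_vec k" "set_mset (mset H) \<subseteq> carrier_vec k" using G(2) H by auto
  have k: "k \<ge> 1" using qk by auto
  have lH: "length H = m" using arg_cong[OF mH, of size] G(1) m by simp
  have nd: "nondegenerate k (mset H)" using nondegenerate_add_simplex[OF qk c eq] G(3) by simp
  have "has_min_wt k e (mset H)" using has_min_wt_add_simplex[OF k c eq] G(4) e by simp
  then have "generated_code k H \<in> LCD_codes_dual2 m k e"
    unfolding LCD_codes_dual2_iff using H lH nd by blast
  moreover have "simplex_extension n m k a C (generated_code k H)"
    unfolding simplex_extension_def using G c lH nd eq by auto
  ultimately show ?thesis by blast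
qed

text \<open>
  The last hypothesis determines \<open>a\<close> as the bound of \<open>multiplicity_lower_bound\<close> on the multiplicity of every
  point.
\<close>
lemma remove_simplices:
  fixes D :: "'a :: {field, finite} vec set"
  assumes qk: "CARD('a) = 2 \<and> k \<ge> 3 \<or> CARD('a) = 3 \<and> k \<ge> 2"
    and D: "D \<in> LCD_codes_dual2 m k e"
    and m: "m = n + a * card (points k :: 'a vec set)" and e: "e = d + a * CARD('a) ^ (k - 1)"
    and a: "CARD('a) * e = (CARD('a) - 1) * m + a"
  shows "\<exists>C\<in>LCD_codes_dual2 n k d. simplex_extension n m k a C D"
proof -
  obtain H where H: "length H = m" "set H \<subseteq> carrier_vec k - {0\<^sub>v k}" "nondegenerate k (mset H)"
      "has_min_wt k e (mset H)" "D = generated_code k H"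
    using D unfolding LCD_codes_dual2_iff by blast
  have k: "k \<ge> 2" using qk by auto
  have cH: "set_mset (mset H) \<subseteq> carrier_vec k" using H(2) by auto
  let ?N = "image_mset rep (mset H)"
  have N: "set_mset ?N \<subseteq> points k"
  proof
    fix v assume "v \<in> set_mset ?N"
    then obtain w where "w \<in> set H" "v = rep w" by auto
    then show "v \<in> points k" using H(2) by (auto simp: points_def)
  qed
  have mult: "a \<le> count ?N p" if p: "p \<in> points k" for p
  proof -
    have "CARD('a) * e \<le> (CARD('a) - 1) * size ?N + count ?N p"
      using H(4) wt_image_rep[OF cH]
      by (intro multiplicity_lower_bound[OF k N p]) (auto simp: has_min_wt_def)
    then show ?thesis using a H(1) by simp
  qed
  have sub: "repeat_mset a (simplex k) \<subseteq># ?N"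
  proof (rule mset_subset_eqI)
    fix p show "count (repeat_mset a (simplex k)) p \<le> count ?N p"
      using mult by (cases "p \<in> points k") auto
  qed
  obtain G where mG: "mset G = ?N - repeat_mset a (simplex k)" using ex_mset by blast
  have G: "set G \<subseteq> points k"
    using N in_diffD[of _ ?N "repeat_mset a (simplex k)"] unfolding set_mset_mset[symmetric] mG by blast
  have "image_mset rep (mset G) = mset G"
    by (rule trans[OF image_mset_cong[where g = "\<lambda>v. v"]]) (use G in \<open>auto intro!: rep_points\<close>)
  then have eq: "?N = image_mset rep (mset G) + repeat_mset a (simplex k)"
    using mG sub by simp
  have c: "set_mset (mset G) \<subseteq> carrier_vec k" using G points_carrier[of k] by auto
  have k1: "k \<ge> 1" using k by simp
  have lG: "length G = n" using arg_cong[OF eq, of size] H(1) m by simp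
  have nd: "nondegenerate k (mset G)" using nondegenerate_add_simplex[OF qk c cH eq] H(3) by simp
  have "has_min_wt k d (mset G)" using has_min_wt_add_simplex[OF k1 c cH eq] H(4) e by simp
  moreover have "set G \<subseteq> carrier_vec k - {0\<^sub>v k}"
    using G points_carrier[of k] zero_notin_points[of k] by blast
  ultimately have "generated_code k G \<in> LCD_codes_dual2 n k d"
    unfolding LCD_codes_dual2_iff using lG nd by blast
  moreover have "simplex_extension n m k a (generated_code k G) D"
    unfolding simplex_extension_def using c cH lG nd eq H by auto
  ultimately show ?thesis by blast
qed

section \<open>The correspondence\<close>

text \<open>
  A relation between two sets of representatives that is total on both sides and matches the two
  equivalence relations induces a bijection of the quotients. A relation is used instead of a function,
  because removing simplices from a code requires a choice of a generator matrix.
\<close>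
lemma bij_betw_quotients:
  assumes R: "equiv X R" and S: "equiv Y S" and A: "A \<subseteq> X" and B: "B \<subseteq> Y"
    and left: "\<And>x. x \<in> A \<Longrightarrow> \<exists>y\<in>B. T x y" and right: "\<And>y. y \<in> B \<Longrightarrow> \<exists>x\<in>A. T x y"
    and T: "\<And>x y x' y'. x \<in> A \<Longrightarrow> x' \<in> A \<Longrightarrow> y \<in> B \<Longrightarrow> y' \<in> B \<Longrightarrow> T x y \<Longrightarrow> T x' y' \<Longrightarrow>
      (x, x') \<in> R \<longleftrightarrow> (y, y') \<in> S"
  shows "\<exists>f. bij_betw f (A // R) (B // S)"
proof -
  obtain t where t: "\<And>x. x \<in> A \<Longrightarrow> t x \<in> B \<and> T x (t x)" using left by metis
  have classR: "R `` {x} = R `` {x'} \<longleftrightarrow> (x, x') \<in> R" if "x \<in> A" "x' \<in> A" for x x'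
    using eq_equiv_class_iff[OF R] A that by blast
  have classS: "S `` {y} = S `` {y'} \<longleftrightarrow> (y, y') \<in> S" if "y \<in> B" "y' \<in> B" for y y'
    using eq_equiv_class_iff[OF S] B that by blast
  define c where "c K = (SOME x. x \<in> A \<and> K = R `` {x})" for K
  have c: "c K \<in> A \<and> K = R `` {c K}" if K: "K \<in> A // R" for K
  proof -
    obtain x where "x \<in> A \<and> K = R `` {x}" using K by (auto elim: quotientE)
    then show ?thesis unfolding c_def by (rule someI)
  qed
  define f where "f K = S `` {t (c K)}" for K
  have "bij_betw f (A // R) (B // S)"
  proof (rule bij_betw_imageI)
    show "inj_on f (A // R)"
    proof (rule inj_onI)
      fix K L assume KL: "K \<in> A // R" "L \<in> A // R" "f K = f L"
      note cK = c[OF KL(1)] and cL = c[OF KL(2)]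
      have "(t (c K), t (c L)) \<in> S" using KL(3) t cK cL by (simp add: f_def classS)
      then have "(c K, c L) \<in> R" using T[of "c K" "c L" "t (c K)" "t (c L)"] t cK cL by blast
      then have "R `` {c K} = R `` {c L}" using classR cK cL by blast
      then show "K = L" using cK cL by blast
    qed
    show "f ` (A // R) = B // S"
    proof (intro equalityI subsetI)
      fix L assume "L \<in> f ` (A // R)"
      then show "L \<in> B // S" using c t by (auto simp: f_def intro!: quotientI)
    next
      fix L assume "L \<in> B // S"
      then obtain y where y: "y \<in> B" "L = S `` {y}" by (auto elim: quotientE)
      obtain x where x: "x \<in> A" "T x y" using right[OF y(1)] by blast
      have K: "R `` {x} \<in> A // R" using x(1) by (rule quotientI)
      note cK = c[OF K]
      have "(c (R `` {x}), x) \<in> R" using classR[of x "c (R `` {x})"] classR[of "c (R `` {x})" x] cK x(1) by blast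
      then have "(t (c (R `` {x})), y) \<in> S"
        using T[of "c (R `` {x})" x "t (c (R `` {x}))" y] t cK x y by blast
      then have "f (R `` {x}) = L" using classS t cK y by (simp add: f_def)
      then show "L \<in> f ` (A // R)" using K by blast
    qed
  qed
  then show ?thesis by blast
qed

lemma LCD_codes_dual2_linear: "LCD_codes_dual2 n k d \<subseteq> {C. linear_code n k C}"
  by (auto simp: LCD_codes_dual2_def LCD_codes_def linear_code_dist_def)

theorem theorem4p5:
  fixes q k\<^sub>0 n k d r :: nat
  assumes "(q, k\<^sub>0) \<in> {(2, 3), (3, 2)}"
    and "card (UNIV :: 'a :: {field, finite} set) = q"
    and "n > 0" and "k > 0" and "d > 0"
    and "k \<ge> k\<^sub>0"
    and "int q * int d - (int q - 1) * int n \<ge> 1"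
    and "int r = int q ^ (k - 1) * int n - int (q_number q k) * int d"
    and "q * r \<ge> k"
  shows "(\<exists>f. bij_betw f
            (LCD_classes_dual2 n k d :: 'a vec set set set)
            (LCD_classes_dual2 (q * r) k ((q - 1) * r) :: 'a vec set set set)) \<and>
         ((LCD_codes_dual2 (q * r) k ((q - 1) * r) :: 'a vec set set) = {} \<longrightarrow>
          (LCD_codes n k d :: 'a vec set set) = {})"
proof -
  have q: "CARD('a) = q" using assms(2) .
  have qk: "CARD('a) = 2 \<and> k \<ge> 3 \<or> CARD('a) = 3 \<and> k \<ge> 2" using assms(1,6) q by auto
  have q23: "CARD('a) \<in> {2, 3}" using qk by auto
  have q1: "q \<ge> 2" using qk q by auto
  define K where "K = card (points k :: 'a vec set)"
  have K: "(q - 1) * K = q ^ k - 1" using card_points[where 'a = 'a] q by (simp add: K_def)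
  have qn: "q_number q k = K" unfolding q_number_def K[symmetric] using q1 by simp
  define Q where "Q = q ^ (k - 1)"
  have "q ^ k = q * Q" using assms(4) by (cases k) (auto simp: Q_def)
  moreover have "Q \<ge> 1" using q1 by (simp add: Q_def)
  ultimately have KQ: "(int q - 1) * int K = int q * int Q - 1"
    using arg_cong[OF K, of int] q1 by (simp add: of_nat_diff)
  define a where "a = nat (int q * int d - (int q - 1) * int n)"
  have a: "int a = int q * int d - (int q - 1) * int n" using assms(7) by (simp add: a_def)
  have r: "int r = int Q * int n - int K * int d" using assms(8) qn by (simp add: Q_def)
  (* Removing a copies of each of the K points leaves length q * r and minimum weight (q - 1) * r. *)
  have "int (q * r + a * K) = int q * int Q * int n - ((int q - 1) * int K) * int n"
    by (simp add: a r algebra_simps)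
  also have "\<dots> = int n" unfolding KQ by (simp add: algebra_simps)
  finally have n: "n = q * r + a * card (points k :: 'a vec set)" unfolding K_def by linarith
  have "int ((q - 1) * r + a * Q) = int q * int Q * int d - ((int q - 1) * int K) * int d"
  proof -
    have "int ((q - 1) * r + a * Q) = (int q - 1) * int r + int a * int Q"
      using q1 by (simp add: of_nat_diff)
    then show ?thesis by (simp add: a r algebra_simps)
  qed
  also have "\<dots> = int d" unfolding KQ by (simp add: algebra_simps)
  finally have d: "d = (q - 1) * r + a * CARD('a) ^ (k - 1)" unfolding Q_def q by linarith
  have "int (q * d) = int ((q - 1) * n + a)" using a q1 by (simp add: of_nat_diff)
  then have bound: "CARD('a) * d = (CARD('a) - 1) * n + a" unfolding q by linarith

  let ?X = "LCD_codes_dual2 n k d :: 'a vec set set"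
  let ?Y = "LCD_codes_dual2 (q * r) k ((q - 1) * r) :: 'a vec set set"
  have down: "\<exists>C\<in>?Y. simplex_extension (q * r) n k a C D" if "D \<in> ?X" for D
    by (rule remove_simplices[OF qk that n d bound])
  have up: "\<exists>D\<in>?X. simplex_extension (q * r) n k a C D" if "C \<in> ?Y" for C
    by (rule add_simplices[OF qk that n d])
  have "\<exists>f. bij_betw f (LCD_classes_dual2 n k d :: 'a vec set set set)
      (LCD_classes_dual2 (q * r) k ((q - 1) * r) :: 'a vec set set set)"
    unfolding LCD_classes_dual2_def
    by (rule bij_betw_quotients[OF equiv_code_equiv equiv_code_equiv
          LCD_codes_dual2_linear LCD_codes_dual2_linear,
          where T = "\<lambda>D (C :: 'a vec set). simplex_extension (q * r) n k a C D"])
      (use down up simplex_extension_code_equiv[symmetric] in \<open>simp_all\<close>)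
  moreover have "?Y \<noteq> {}" if nonempty: "(LCD_codes n k d :: 'a vec set set) \<noteq> {}"
  proof -
    obtain C :: "'a vec set" where C: "C \<in> LCD_codes n k d" using nonempty by blast
    then obtain G :: "'a vec list" where G: "length G = n" "set G \<subseteq> carrier_vec k"
        "nondegenerate k (mset G)" "has_min_wt k d (mset G)" "C = generated_code k G"
      unfolding LCD_codes_iff by blast
    consider "k \<ge> 3" | "0\<^sub>v k \<notin> set G" | "q = 3" "k = 2" "0\<^sub>v k \<in> set G"
    proof -
      have "k \<ge> 3 \<or> q = 3 \<and> k = 2" using qk q by linarith
      then show thesis using that by blast
    qed
    then show ?thesis
    proof cases
      case 1
      then show ?thesis using fill_zero_columns[OF q23 1 C] down by blast
    next
      case 2
      then have "C \<in> ?X" unfolding LCD_codes_dual2_iff using G by blast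
      then show ?thesis using down by blast
    next
      case 3
      let ?N = "filter_mset (\<lambda>v. v \<noteq> 0\<^sub>v k) (mset G)"
      have "(CARD('a) ^ k - 1) * d \<le> (CARD('a) - 1) * CARD('a) ^ (k - 1) * size ?N"
        using G(2,4) wt_nonzero_columns[of _ k "mset G"] 3
        by (intro average_weight_bound) (auto simp: has_min_wt_def)
      (* A zero column leaves room for at least 3 in r = 3 * n - 4 * d. *)
      then have "8 * d \<le> 6 * size ?N" using 3 q by simp
      moreover have "n = size ?N + count (mset G) (0\<^sub>v k)"
        using arg_cong[OF split_zero_columns[of "mset G" "0\<^sub>v k"], of size] G(1) by simp
      moreover have "count (mset G) (0\<^sub>v k) \<ge> 1" using 3 by (simp add: Suc_le_eq)
      moreover have "int r = 3 * int n - 4 * int d" using r K 3 by (simp add: Q_def)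
      ultimately have "r \<ge> 2" by linarith
      then show ?thesis using ternary_plane_code[of r, where 'a = 'a] 3 q by auto
    qed
  qed
  ultimately show ?thesis by blast
qed

end
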